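(* Let $\mathbb{X}$ be an exact Mal'tsev category and $n\geq 1$. An $n$-fold equivalence relation in $\mathbb{X}$ is effective if and only if it is parallelistic.
   Context: An exact Mal'tsev category is a Barr exact category in which every (internal) reflexive relation is an equivalence relation. $\mathsf{Arr}^n(\mathbb{X})=\mathsf{Arr}(\mathsf{Arr}^{n-1}(\mathbb{X}))$ is the category of $n$-fold arrows (commutative $n$-cubes). $\mathsf{RGrph}(\mathbb{X})$ is the category of reflexive graphs in $\mathbb{X}$, $\mathsf{RGrph}^n(\mathbb{X})=\mathsf{RGrph}(\mathsf{RGrph}^{n-1}(\mathbb{X}))$. $\mathsf{ERel}(\mathbb{X})$ is the category of equivalence relations in $\mathbb{X}$, and $\mathsf{ERel}^n(\mathbb{X})=\mathsf{ERel}(\mathsf{ERel}^{n-1}(\mathbb{X}))$ is the category of $n$-fold equivalence relations, a full subcategory of $\mathsf{RGrph}^n(\mathbb{X})$. An $n$-fold equivalence relation has an underlying object $X$ and $n$ underlying equivalence relations $R_0,\dots,R_{n-1}$ on $X$, one for each direction; it is then said to be an $n$-fold equivalence relation on $R_0,\dots,R_{n-1}$. Effective: $\mathrm{Eq}\colon\mathsf{Arr}(\mathbb{X})\to\mathsf{RGrph}(\mathbb{X})$ sends an arrow to its kernel pair, and $\mathrm{Eq}^n=\mathrm{Eq}\circ\mathsf{Arr}(\mathrm{Eq}^{n-1})\colon \mathsf{Arr}^n(\mathbb{X})\to\mathsf{RGrph}^n(\mathbb{X})$. An $n$-fold equivalence relation is effective when it is isomorphic to one of the form $\mathrm{Eq}^n(F)$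 for some $n$-fold arrow $F$. Parallelistic: the forgetful functor $U$ from $\mathsf{ERel}^n(\mathbb{X})$ to the category of $n$-tuples of equivalence relations on a common object, sending an $n$-fold equivalence relation on $R_0,\dots,R_{n-1}$ to $(R_0,\dots,R_{n-1})$, has a right adjoint $\square$, sending $(R_i)_{i\in n}$ to the largest $n$-fold equivalence relation $\square_{i\in n}R_i$ on $R_0,\dots,R_{n-1}$. Its top object is the subobject of $X^{2^n}$ of "families" $(x_a)_{a\in\{0,1\}^n}$ such that $x_a R_i x_b$ whenever $a$ and $b$ differ only in coordinate $i$. An $n$-fold equivalence relation is parallelistic when it is isomorphic to some $\square_{i\in n}R_i$. *)

theory Defs
  imports Main
begin

section \<open>Categories\<close>

record ('o, 'm) category =
  Obj :: "'o set"
  Mor :: "'m set"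
  Dom :: "'m \<Rightarrow> 'o"
  Cod :: "'m \<Rightarrow> 'o"
  Ide :: "'o \<Rightarrow> 'm"
  Cmp :: "'m \<Rightarrow> 'm \<Rightarrow> 'm"  (infixl "\<cdot>\<index>" 70)  (* g \<cdot> f is "g after f" *)

definition hom :: "('o, 'm) category \<Rightarrow> 'o \<Rightarrow> 'o \<Rightarrow> 'm set" where
  "hom C a b = {f \<in> Mor C. Dom C f = a \<and> Cod C f = b}"

locale category =
  fixes C :: "('o, 'm) category" (structure)
  assumes dom_obj: "f \<in> Mor C \<Longrightarrow> Dom C f \<in> Obj C"
    and cod_obj: "f \<in> Mor C \<Longrightarrow> Cod C f \<in> Obj C"
    and ide_hom: "a \<in> Obj C \<Longrightarrow> Ide C a \<in> hom C a a"
    and cmp_hom: "f \<in> hom C a b \<Longrightarrow> g \<in> hom C b c \<Longrightarrow> g \<cdot> f \<in> hom C a c"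
    and ide_right: "f \<in> hom C a b \<Longrightarrow> f \<cdot> Ide C a = f"
    and ide_left: "f \<in> hom C a b \<Longrightarrow> Ide C b \<cdot> f = f"
    and assoc: "f \<in> hom C a b \<Longrightarrow> g \<in> hom C b c \<Longrightarrow> h \<in> hom C c d \<Longrightarrow>
                  h \<cdot> (g \<cdot> f) = (h \<cdot> g) \<cdot> f"

definition isomorphic :: "('o, 'm) category \<Rightarrow> 'o \<Rightarrow> 'o \<Rightarrow> bool" where
  "isomorphic C a b \<longleftrightarrow>
     (\<exists>f \<in> hom C a b. \<exists>g \<in> hom C b a. g \<cdot>\<^bsub>C\<^esub> f = Ide C a \<and> f \<cdot>\<^bsub>C\<^esub> g = Ide C b)"

definition full_subcategory :: "('o, 'm) category \<Rightarrow> 'o set \<Rightarrow> ('o, 'm) category" where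
  "full_subcategory C S =
     C\<lparr>Obj := Obj C \<inter> S, Mor := {f \<in> Mor C. Dom C f \<in> S \<and> Cod C f \<in> S}\<rparr>"

record ('a, 'f, 'b, 'g) functor_data =
  on_obj :: "'a \<Rightarrow> 'b"
  on_mor :: "'f \<Rightarrow> 'g"

definition id_functor :: "('a, 'f, 'a, 'f) functor_data" where
  "id_functor = \<lparr>on_obj = id, on_mor = id\<rparr>"

definition comp_functor ::
  "('b, 'g, 'c, 'h) functor_data \<Rightarrow> ('a, 'f, 'b, 'g) functor_data \<Rightarrow> ('a, 'f, 'c, 'h) functor_data"
  (infixl "\<circ>\<^sub>F" 55) where
  "G \<circ>\<^sub>F F = \<lparr>on_obj = on_obj G \<circ> on_obj F, on_mor = on_mor G \<circ> on_mor F\<rparr>"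


section \<open>Exact Mal'tsev categories\<close>

definition is_terminal :: "('o, 'm) category \<Rightarrow> 'o \<Rightarrow> bool" where
  "is_terminal C t \<longleftrightarrow> t \<in> Obj C \<and> (\<forall>a \<in> Obj C. \<exists>!f. f \<in> hom C a t)"

definition is_pullback :: "('o, 'm) category \<Rightarrow> 'm \<Rightarrow> 'm \<Rightarrow> 'm \<Rightarrow> 'm \<Rightarrow> bool" where
  "is_pullback C f g p q \<longleftrightarrow>
     f \<in> Mor C \<and> g \<in> Mor C \<and> p \<in> Mor C \<and> q \<in> Mor C \<and>
     Cod C f = Cod C g \<and> Dom C p = Dom C q \<and> Cod C p = Dom C f \<and> Cod C q = Dom C g \<and>
     f \<cdot>\<^bsub>C\<^esub> p = g \<cdot>\<^bsub>C\<^esub> q \<and>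
     (\<forall>z \<in> Obj C. \<forall>u \<in> hom C z (Dom C f). \<forall>v \<in> hom C z (Dom C g). f \<cdot>\<^bsub>C\<^esub> u = g \<cdot>\<^bsub>C\<^esub> v \<longrightarrow>
        (\<exists>!h. h \<in> hom C z (Dom C p) \<and> p \<cdot>\<^bsub>C\<^esub> h = u \<and> q \<cdot>\<^bsub>C\<^esub> h = v))"

definition finitely_complete :: "('o, 'm) category \<Rightarrow> bool" where
  "finitely_complete C \<longleftrightarrow> category C \<and> (\<exists>t. is_terminal C t) \<and>
     (\<forall>f \<in> Mor C. \<forall>g \<in> Mor C. Cod C f = Cod C g \<longrightarrow> (\<exists>p q. is_pullback C f g p q))"

abbreviation is_kernel_pair :: "('o, 'm) category \<Rightarrow> 'm \<Rightarrow> 'm \<Rightarrow> 'm \<Rightarrow> bool" where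
  "is_kernel_pair C f p q \<equiv> is_pullback C f f p q"

definition is_coequalizer :: "('o, 'm) category \<Rightarrow> 'm \<Rightarrow> 'm \<Rightarrow> 'm \<Rightarrow> bool" where
  "is_coequalizer C u v e \<longleftrightarrow>
     u \<in> Mor C \<and> v \<in> Mor C \<and> e \<in> Mor C \<and>
     Dom C u = Dom C v \<and> Cod C u = Cod C v \<and> Dom C e = Cod C u \<and>
     e \<cdot>\<^bsub>C\<^esub> u = e \<cdot>\<^bsub>C\<^esub> v \<and>
     (\<forall>k \<in> Mor C. Dom C k = Cod C u \<and> k \<cdot>\<^bsub>C\<^esub> u = k \<cdot>\<^bsub>C\<^esub> v \<longrightarrow>
        (\<exists>!h. h \<in> hom C (Cod C e) (Cod C k) \<and> h \<cdot>\<^bsub>C\<^esub> e = k))"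

definition regular_epi :: "('o, 'm) category \<Rightarrow> 'm \<Rightarrow> bool" where
  "regular_epi C e \<longleftrightarrow> (\<exists>u v. is_coequalizer C u v e)"

definition regular_category :: "('o, 'm) category \<Rightarrow> bool" where
  "regular_category C \<longleftrightarrow> finitely_complete C \<and>
     (\<forall>f p q. is_kernel_pair C f p q \<longrightarrow> (\<exists>e. is_coequalizer C p q e)) \<and>
     (\<forall>f g p q. is_pullback C f g p q \<and> regular_epi C f \<longrightarrow> regular_epi C q)"

definition reflexive_graph :: "('o, 'm) category \<Rightarrow> 'm \<Rightarrow> 'm \<Rightarrow> 'm \<Rightarrow> bool" where
  "reflexive_graph C d c s \<longleftrightarrow>
     d \<in> Mor C \<and> c \<in> Mor C \<and> Dom C d = Dom C c \<and> Cod C d = Cod C c \<and>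
     s \<in> hom C (Cod C d) (Dom C d) \<and>
     d \<cdot>\<^bsub>C\<^esub> s = Ide C (Cod C d) \<and> c \<cdot>\<^bsub>C\<^esub> s = Ide C (Cod C d)"

definition jointly_monic :: "('o, 'm) category \<Rightarrow> 'm \<Rightarrow> 'm \<Rightarrow> bool" where
  "jointly_monic C d c \<longleftrightarrow>
     d \<in> Mor C \<and> c \<in> Mor C \<and> Dom C d = Dom C c \<and>
     (\<forall>z \<in> Obj C. \<forall>u \<in> hom C z (Dom C d). \<forall>v \<in> hom C z (Dom C d).
        d \<cdot>\<^bsub>C\<^esub> u = d \<cdot>\<^bsub>C\<^esub> v \<and> c \<cdot>\<^bsub>C\<^esub> u = c \<cdot>\<^bsub>C\<^esub> v \<longrightarrow> u = v)"

definition reflexive_relation :: "('o, 'm) category \<Rightarrow> 'm \<Rightarrow> 'm \<Rightarrow> bool" where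
  "reflexive_relation C d c \<longleftrightarrow> jointly_monic C d c \<and> (\<exists>s. reflexive_graph C d c s)"

text \<open>The relation that \<open>d, c : R \<rightarrow> X\<close> induces on the generalized elements \<open>z \<rightarrow> X\<close>. Asking it to
  be an equivalence for every \<open>z\<close> makes sense whether or not \<open>C\<close> has pullbacks, and agrees with
  the internal formulation when it does.\<close>

definition elem_rel :: "('o, 'm) category \<Rightarrow> 'm \<Rightarrow> 'm \<Rightarrow> 'o \<Rightarrow> ('m \<times> 'm) set" where
  "elem_rel C d c z = {(d \<cdot>\<^bsub>C\<^esub> h, c \<cdot>\<^bsub>C\<^esub> h) | h. h \<in> hom C z (Dom C d)}"

definition equivalence_relation :: "('o, 'm) category \<Rightarrow> 'm \<Rightarrow> 'm \<Rightarrow> bool" where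
  "equivalence_relation C d c \<longleftrightarrow>
     jointly_monic C d c \<and> Cod C d = Cod C c \<and>
     (\<forall>z \<in> Obj C. equiv (hom C z (Cod C d)) (elem_rel C d c z))"

definition exact_category :: "('o, 'm) category \<Rightarrow> bool" where
  "exact_category C \<longleftrightarrow> regular_category C \<and>
     (\<forall>d c. equivalence_relation C d c \<longrightarrow> (\<exists>f. is_kernel_pair C f d c))"

definition exact_maltsev :: "('o, 'm) category \<Rightarrow> bool" where
  "exact_maltsev C \<longleftrightarrow> exact_category C \<and>
     (\<forall>d c. reflexive_relation C d c \<longrightarrow> equivalence_relation C d c)"


section \<open>Iterable constructions on categories\<close>

text \<open>In order that arrow categories and categories of reflexive graphs can be iterated \<open>n\<close> times for
  a variable \<open>n\<close>, objects and morphisms of all the categories involved live in one type: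
  \<^item> \<open>Ob\<close> and \<open>Mo\<close> embed the objects and morphisms of the base category;
  \<^item> \<open>Graph d c s\<close> is a reflexive graph with domain \<open>d\<close>, codomain \<open>c\<close> and unit \<open>s\<close>;
  \<^item> \<open>Map x y u l\<close> is a morphism \<open>x \<rightarrow> y\<close> in an arrow category (\<open>u\<close> between the domains of \<open>x\<close> and
    \<open>y\<close>, \<open>l\<close> between their codomains) or between reflexive graphs (\<open>u\<close> between the objects
    of edges, \<open>l\<close> between the objects of vertices);
  \<^item> \<open>Tuple\<close> serves for tuples of equivalence relations.\<close>

datatype ('o, 'm) cell =
    Ob (base_obj: 'o)
  | Mo (base_mor: 'm)
  | Graph (gdom: "('o, 'm) cell") (gcod: "('o, 'm) cell") (gunit: "('o, 'm) cell")
  | Map (source: "('o, 'm) cell") (target: "('o, 'm) cell")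
        (upper: "('o, 'm) cell") (lower: "('o, 'm) cell")
  | Tuple (entries: "('o, 'm) cell list")

type_synonym ('o, 'm) cell_category = "(('o, 'm) cell, ('o, 'm) cell) category"
type_synonym ('o, 'm) cell_functor =
  "(('o, 'm) cell, ('o, 'm) cell, ('o, 'm) cell, ('o, 'm) cell) functor_data"

definition embed :: "('o, 'm) category \<Rightarrow> ('o, 'm) cell_category" where
  "embed C =
     \<lparr>Obj = Ob ` Obj C,
      Mor = Mo ` Mor C,
      Dom = (\<lambda>f. Ob (Dom C (base_mor f))),
      Cod = (\<lambda>f. Ob (Cod C (base_mor f))),
      Ide = (\<lambda>a. Mo (Ide C (base_obj a))),
      Cmp = (\<lambda>g f. Mo (base_mor g \<cdot>\<^bsub>C\<^esub> base_mor f))\<rparr>"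

definition Arr :: "('o, 'm) cell_category \<Rightarrow> ('o, 'm) cell_category" where
  "Arr C =
     \<lparr>Obj = Mor C,
      Mor = {Map f g u l | f g u l.
               f \<in> Mor C \<and> g \<in> Mor C \<and>
               u \<in> hom C (Dom C f) (Dom C g) \<and> l \<in> hom C (Cod C f) (Cod C g) \<and>
               l \<cdot>\<^bsub>C\<^esub> f = g \<cdot>\<^bsub>C\<^esub> u},
      Dom = source,
      Cod = target,
      Ide = (\<lambda>f. Map f f (Ide C (Dom C f)) (Ide C (Cod C f))),
      Cmp = (\<lambda>k h. Map (source h) (target k) (upper k \<cdot>\<^bsub>C\<^esub> upper h) (lower k \<cdot>\<^bsub>C\<^esub> lower h))\<rparr>"

definition RGrph :: "('o, 'm) cell_category \<Rightarrow> ('o, 'm) cell_category" where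
  "RGrph C =
     \<lparr>Obj = {Graph d c s | d c s. reflexive_graph C d c s},
      Mor = {Map (Graph d c s) (Graph d' c' s') u l | d c s d' c' s' u l.
               reflexive_graph C d c s \<and> reflexive_graph C d' c' s' \<and>
               u \<in> hom C (Dom C d) (Dom C d') \<and> l \<in> hom C (Cod C d) (Cod C d') \<and>
               d' \<cdot>\<^bsub>C\<^esub> u = l \<cdot>\<^bsub>C\<^esub> d \<and> c' \<cdot>\<^bsub>C\<^esub> u = l \<cdot>\<^bsub>C\<^esub> c \<and> s' \<cdot>\<^bsub>C\<^esub> l = u \<cdot>\<^bsub>C\<^esub> s},
      Dom = source,
      Cod = target,
      Ide = (\<lambda>G. Map G G (Ide C (Dom C (gdom G))) (Ide C (Cod C (gdom G)))),
      Cmp = (\<lambda>k h. Map (source h) (target k) (upper k \<cdot>\<^bsub>C\<^esub> upper h) (lower k \<cdot>\<^bsub>C\<^esub> lower h))\<rparr>"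

definition ERel :: "('o, 'm) cell_category \<Rightarrow> ('o, 'm) cell_category" where
  "ERel C = full_subcategory (RGrph C) {G. equivalence_relation C (gdom G) (gcod G)}"

primrec Arr_n :: "nat \<Rightarrow> ('o, 'm) category \<Rightarrow> ('o, 'm) cell_category" where
  "Arr_n 0 X = embed X"
| "Arr_n (Suc n) X = Arr (Arr_n n X)"

primrec RGrph_n :: "nat \<Rightarrow> ('o, 'm) category \<Rightarrow> ('o, 'm) cell_category" where
  "RGrph_n 0 X = embed X"
| "RGrph_n (Suc n) X = RGrph (RGrph_n n X)"

primrec ERel_n :: "nat \<Rightarrow> ('o, 'm) category \<Rightarrow> ('o, 'm) cell_category" where
  "ERel_n 0 X = embed X"
| "ERel_n (Suc n) X = ERel (ERel_n n X)"


section \<open>Effective n-fold equivalence relations\<close>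

definition Arr_functor :: "('o, 'm) cell_functor \<Rightarrow> ('o, 'm) cell_functor" where
  "Arr_functor F =
     \<lparr>on_obj = on_mor F,
      on_mor = (\<lambda>h. Map (on_mor F (source h)) (on_mor F (target h))
                        (on_mor F (upper h)) (on_mor F (lower h)))\<rparr>"

definition kernel_graph :: "('o, 'm) cell_category \<Rightarrow> ('o, 'm) cell \<Rightarrow> ('o, 'm) cell" where
  "kernel_graph C f = (SOME G. G \<in> Obj (RGrph C) \<and> is_kernel_pair C f (gdom G) (gcod G))"

text \<open>A morphism into a kernel pair is determined by its vertex component, which here is the
  component between the domains of the two arrows.\<close>

definition Eq :: "('o, 'm) cell_category \<Rightarrow> ('o, 'm) cell_functor" where
  "Eq C =
     \<lparr>on_obj = kernel_graph C,
      on_mor = (\<lambda>h. THE k. k \<in> hom (RGrph C) (kernel_graph C (source h)) (kernel_graph C (target h))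
                          \<and> lower k = upper h)\<rparr>"

primrec Eq_n :: "nat \<Rightarrow> ('o, 'm) category \<Rightarrow> ('o, 'm) cell_functor" where
  "Eq_n 0 X = id_functor"
| "Eq_n (Suc n) X = Eq (RGrph_n n X) \<circ>\<^sub>F Arr_functor (Eq_n n X)"

definition effective :: "nat \<Rightarrow> ('o, 'm) category \<Rightarrow> ('o, 'm) cell \<Rightarrow> bool" where
  "effective n X E \<longleftrightarrow>
     (\<exists>F \<in> Obj (Arr_n n X). isomorphic (RGrph_n n X) E (on_obj (Eq_n n X) F))"


section \<open>Parallelistic n-fold equivalence relations\<close>

definition vertices :: "('o, 'm) cell_category \<Rightarrow> ('o, 'm) cell_functor" where
  "vertices C = \<lparr>on_obj = (\<lambda>G. Cod C (gdom G)), on_mor = lower\<rparr>"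

definition RGrph_functor :: "('o, 'm) cell_functor \<Rightarrow> ('o, 'm) cell_functor" where
  "RGrph_functor F =
     (let ob = (\<lambda>G. Graph (on_mor F (gdom G)) (on_mor F (gcod G)) (on_mor F (gunit G)))
      in \<lparr>on_obj = ob,
          on_mor = (\<lambda>h. Map (ob (source h)) (ob (target h))
                            (on_mor F (upper h)) (on_mor F (lower h)))\<rparr>)"

primrec underlying_object :: "nat \<Rightarrow> ('o, 'm) category \<Rightarrow> ('o, 'm) cell_functor" where
  "underlying_object 0 X = id_functor"
| "underlying_object (Suc n) X = underlying_object n X \<circ>\<^sub>F vertices (RGrph_n n X)"

text \<open>\<open>direction n X i\<close>, for \<open>i < n\<close>, takes an \<open>n\<close>-fold reflexive graph to its underlying reflexive
  graph in direction \<open>i\<close>, on its underlying object; the outermost direction comes last.\<close>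

primrec direction :: "nat \<Rightarrow> ('o, 'm) category \<Rightarrow> nat \<Rightarrow> ('o, 'm) cell_functor" where
  "direction 0 X i = undefined"
| "direction (Suc n) X i =
     (if i = n then RGrph_functor (underlying_object n X)
      else direction n X i \<circ>\<^sub>F vertices (RGrph_n n X))"

text \<open>The category of \<open>n\<close>-tuples of equivalence relations on a common object: an object is
  \<open>Tuple (x # Rs)\<close> with \<open>Rs\<close> a list of \<open>n\<close> equivalence relations on \<open>x\<close>; a morphism is a
  morphism \<open>f\<close> between the common objects with \<open>n\<close> morphisms of equivalence relations over \<open>f\<close>.\<close>

definition ERel_tuples :: "nat \<Rightarrow> ('o, 'm) category \<Rightarrow> ('o, 'm) cell_category" where
  "ERel_tuples n X =
     (let B = embed X; V = vertices B in
      \<lparr>Obj = {Tuple (x # Rs) | x Rs. x \<in> Obj B \<and> length Rs = n \<and>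
                (\<forall>R \<in> set Rs. R \<in> Obj (ERel B) \<and> on_obj V R = x)},
       Mor = {Tuple (f # rs) | f rs. f \<in> Mor B \<and> length rs = n \<and>
                (\<forall>r \<in> set rs. r \<in> Mor (ERel B) \<and> on_mor V r = f)},
       Dom = (\<lambda>h. Tuple (Dom B (hd (entries h)) # map (Dom (ERel B)) (tl (entries h)))),
       Cod = (\<lambda>h. Tuple (Cod B (hd (entries h)) # map (Cod (ERel B)) (tl (entries h)))),
       Ide = (\<lambda>a. Tuple (Ide B (hd (entries a)) # map (Ide (ERel B)) (tl (entries a)))),
       Cmp = (\<lambda>k h. Tuple (Cmp B (hd (entries k)) (hd (entries h))
                            # map2 (Cmp (ERel B)) (tl (entries k)) (tl (entries h))))\<rparr>)"

definition U :: "nat \<Rightarrow> ('o, 'm) category \<Rightarrow> ('o, 'm) cell_functor" where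
  "U n X =
     \<lparr>on_obj = (\<lambda>E. Tuple (on_obj (underlying_object n X) E
                            # map (\<lambda>i. on_obj (direction n X i) E) [0..<n])),
      on_mor = (\<lambda>h. Tuple (on_mor (underlying_object n X) h
                            # map (\<lambda>i. on_mor (direction n X i) h) [0..<n]))\<rparr>"

definition universal_from_functor ::
  "('a, 'f) category \<Rightarrow> ('b, 'g) category \<Rightarrow> ('a, 'f, 'b, 'g) functor_data \<Rightarrow> 'b \<Rightarrow> 'a \<Rightarrow> 'g \<Rightarrow> bool"
where
  "universal_from_functor C D F b a e \<longleftrightarrow>
     a \<in> Obj C \<and> b \<in> Obj D \<and> e \<in> hom D (on_obj F a) b \<and>
     (\<forall>a' \<in> Obj C. \<forall>g \<in> hom D (on_obj F a') b. \<exists>!h. h \<in> hom C a' a \<and> e \<cdot>\<^bsub>D\<^esub> on_mor F h = g)"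

text \<open>\<open>E\<close> is the largest \<open>n\<close>-fold equivalence relation on the tuple \<open>R\<close>, that is, the value at \<open>R\<close> of
  the right adjoint \<open>\<box>\<close> of \<open>U\<close>: \<open>E\<close> lies over \<open>R\<close>, and the identity of \<open>R\<close> is the counit. This
  determines \<open>E\<close> up to isomorphism.\<close>

definition is_square :: "nat \<Rightarrow> ('o, 'm) category \<Rightarrow> ('o, 'm) cell \<Rightarrow> ('o, 'm) cell \<Rightarrow> bool" where
  "is_square n X R E \<longleftrightarrow>
     on_obj (U n X) E = R \<and>
     universal_from_functor (ERel_n n X) (ERel_tuples n X) (U n X) R E (Ide (ERel_tuples n X) R)"

definition parallelistic :: "nat \<Rightarrow> ('o, 'm) category \<Rightarrow> ('o, 'm) cell \<Rightarrow> bool" where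
  "parallelistic n X E \<longleftrightarrow>
     (\<exists>R \<in> Obj (ERel_tuples n X). \<exists>S. is_square n X R S \<and> isomorphic (ERel_n n X) E S)"

end

theory Submission
  imports Defs
begin

text \<open>Kernel pairs of morphisms of reflexive graphs are computed levelwise, and morphisms of \<open>n\<close>-fold
  equivalence relations are determined by their action on the underlying objects. It follows that
  \<open>Eq_n F\<close> depends only on the \<open>n\<close> edges \<open>f\<^sub>i\<close> of the cube \<open>F\<close> out of its initial vertex: a morphism
  between the underlying objects lifts to \<open>E \<rightarrow> Eq_n F\<close> as soon as it sends, for every \<open>i\<close>, the \<open>i\<close>th
  relation of \<open>E\<close> into the kernel pair of \<open>f\<^sub>i\<close>. So \<open>Eq_n F\<close> is the largest \<open>n\<close>-fold equivalence relation
  on the kernel pairs of the \<open>f\<^sub>i\<close>. Conversely, by exactness every tuple of equivalence relations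
  consists of kernel pairs of some \<open>f\<^sub>i\<close>, and these are the initial edges of a cube whose remaining
  vertices are terminal.\<close>

subsection \<open>Categories\<close>

text \<open>Two iterations must be reconciled: \<open>Eq_n\<close> takes kernel pairs among
  \<open>n\<close>-fold reflexive graphs, whereas \<open>ERel_n (Suc n)\<close> asks for equivalence
  relations internal to \<open>ERel_n n\<close>. The bridge is that \<open>ERel_n n\<close> is a
  full subcategory of \<open>RGrph_n n\<close>, closed under kernel pairs of morphisms between its
  objects. The lifting depends on it, since faithfulness of the underlying object rests on a joint
  monicity that is available in \<open>ERel_n\<close>. Moreover \<open>kernel_graph\<close> is an
  arbitrary choice, so the edge objects of \<open>Eq_n F\<close> are known only up to isomorphism:
  the levelwise description is proved for one constructed kernel pair and transported to every
  other. For the same reason a square on given relations and the \<open>Eq_n F\<close> of a cube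
  whose edges have these relations as kernel pairs agree on the underlying object, but not literally
  on the relations. They are compared by two morphisms over the identity, one from the lifting and
  one from the universal property of the square; faithfulness makes them mutually inverse.\<close>

lemma homI: "f \<in> Mor C \<Longrightarrow> Dom C f = a \<Longrightarrow> Cod C f = b \<Longrightarrow> f \<in> hom C a b"
  by (simp add: hom_def)

lemma homD:
  assumes "f \<in> hom C a b"
  shows "f \<in> Mor C" "Dom C f = a" "Cod C f = b"
  using assms by (auto simp: hom_def)

context category
begin

lemma cmp_Mor:
  assumes "f \<in> Mor C" "g \<in> Mor C" "Dom C g = Cod C f"
  shows "g \<cdot> f \<in> Mor C" "Dom C (g \<cdot> f) = Dom C f" "Cod C (g \<cdot> f) = Cod C g"
  using cmp_hom[of f "Dom C f" "Cod C f" g "Cod C g"] assms by (auto simp: hom_def)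

lemma ide_Mor:
  assumes "a \<in> Obj C"
  shows "Ide C a \<in> Mor C" "Dom C (Ide C a) = a" "Cod C (Ide C a) = a"
  using ide_hom[OF assms] by (auto simp: hom_def)

lemma cmp_assoc:
  assumes "f \<in> Mor C" "g \<in> Mor C" "h \<in> Mor C" "Dom C g = Cod C f" "Dom C h = Cod C g"
  shows "(h \<cdot> g) \<cdot> f = h \<cdot> (g \<cdot> f)"
  using assoc[of f "Dom C f" "Cod C f" g "Cod C g" h "Cod C h"] assms by (auto simp: hom_def)

lemma cmp_ide:
  assumes "f \<in> Mor C"
  shows "Cod C f = b \<Longrightarrow> Ide C b \<cdot> f = f" "Dom C f = a \<Longrightarrow> f \<cdot> Ide C a = f"
  using ide_left[of f "Dom C f" "Cod C f"] ide_right[of f "Dom C f" "Cod C f"] assms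
  by (auto simp: hom_def)

lemmas cat_simps = cmp_Mor ide_Mor cmp_assoc cmp_ide dom_obj cod_obj

text \<open>The workhorse of all diagram chases. Composition is partial, so reassociating around a
  known square costs typing conditions at every step; collecting them here lets the simplifier
  discharge them at once.\<close>

lemma square_cmp:
  assumes "a \<cdot> b = c \<cdot> e"
    and "a \<in> Mor C" "b \<in> Mor C" "c \<in> Mor C" "e \<in> Mor C" "x \<in> Mor C"
    and "Dom C a = Cod C b" "Dom C c = Cod C e" "Dom C b = Cod C x" "Dom C e = Cod C x"
  shows "a \<cdot> (b \<cdot> x) = c \<cdot> (e \<cdot> x)"
  using assms cmp_assoc[of x b a] cmp_assoc[of x e c] by simp

end

section \<open>Kernel pairs: lifting, uniqueness, transport along isomorphisms\<close>

definition has_kernel_pairs :: "('o, 'm) category \<Rightarrow> bool" where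
  "has_kernel_pairs C \<longleftrightarrow> (\<forall>f \<in> Mor C. \<exists>p q. is_kernel_pair C f p q)"

lemma kernel_pairD:
  assumes "is_kernel_pair C f p q"
  shows "f \<in> Mor C" "p \<in> Mor C" "q \<in> Mor C" "Dom C q = Dom C p"
    "Cod C p = Dom C f" "Cod C q = Dom C f" "f \<cdot>\<^bsub>C\<^esub> p = f \<cdot>\<^bsub>C\<^esub> q"
  using assms by (auto simp: is_pullback_def)

lemma kernel_pair_ex1:
  assumes "is_kernel_pair C f p q" "z \<in> Obj C" "u \<in> hom C z (Dom C f)" "v \<in> hom C z (Dom C f)"
    and "f \<cdot>\<^bsub>C\<^esub> u = f \<cdot>\<^bsub>C\<^esub> v"
  shows "\<exists>!h. h \<in> hom C z (Dom C p) \<and> p \<cdot>\<^bsub>C\<^esub> h = u \<and> q \<cdot>\<^bsub>C\<^esub> h = v"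
  using assms unfolding is_pullback_def by blast

lemma kernel_pair_lift:
  assumes "is_kernel_pair C f p q" "z \<in> Obj C" "u \<in> hom C z (Dom C f)" "v \<in> hom C z (Dom C f)"
    and "f \<cdot>\<^bsub>C\<^esub> u = f \<cdot>\<^bsub>C\<^esub> v"
  obtains h where "h \<in> hom C z (Dom C p)" "p \<cdot>\<^bsub>C\<^esub> h = u" "q \<cdot>\<^bsub>C\<^esub> h = v"
  using kernel_pair_ex1[OF assms] by blast

lemma jointly_monicD:
  assumes "jointly_monic C d c" "z \<in> Obj C" "u \<in> hom C z (Dom C d)" "v \<in> hom C z (Dom C d)"
    and "d \<cdot>\<^bsub>C\<^esub> u = d \<cdot>\<^bsub>C\<^esub> v" "c \<cdot>\<^bsub>C\<^esub> u = c \<cdot>\<^bsub>C\<^esub> v"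
  shows "u = v"
  using assms unfolding jointly_monic_def by blast

text \<open>Uniqueness of lifts is the same for all pairs of maps into the kernel object, so it is
  split off as joint monicity; only existence remains to be checked pair by pair.\<close>

lemma kernel_pairI:
  assumes "f \<in> Mor C" "jointly_monic C p q" "Cod C p = Dom C f" "Cod C q = Dom C f"
    and "f \<cdot>\<^bsub>C\<^esub> p = f \<cdot>\<^bsub>C\<^esub> q"
    and "\<And>z u v. z \<in> Obj C \<Longrightarrow> u \<in> hom C z (Dom C f) \<Longrightarrow> v \<in> hom C z (Dom C f) \<Longrightarrow>
          f \<cdot>\<^bsub>C\<^esub> u = f \<cdot>\<^bsub>C\<^esub> v \<Longrightarrow> \<exists>h \<in> hom C z (Dom C p). p \<cdot>\<^bsub>C\<^esub> h = u \<and> q \<cdot>\<^bsub>C\<^esub> h = v"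
  shows "is_kernel_pair C f p q"
proof -
  have ex: "\<exists>!h. h \<in> hom C z (Dom C p) \<and> p \<cdot>\<^bsub>C\<^esub> h = u \<and> q \<cdot>\<^bsub>C\<^esub> h = v"
    if z: "z \<in> Obj C" "u \<in> hom C z (Dom C f)" "v \<in> hom C z (Dom C f)" "f \<cdot>\<^bsub>C\<^esub> u = f \<cdot>\<^bsub>C\<^esub> v" for z u v
  proof -
    obtain h where "h \<in> hom C z (Dom C p)" "p \<cdot>\<^bsub>C\<^esub> h = u" "q \<cdot>\<^bsub>C\<^esub> h = v"
      using assms(6)[OF z] by blast
    then show ?thesis
      using jointly_monicD[OF assms(2) z(1)] by metis
  qed
  have "p \<in> Mor C" "q \<in> Mor C" "Dom C p = Dom C q"
    using assms(2) by (simp_all add: jointly_monic_def)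
  then show ?thesis
    using assms(1,3-5) unfolding is_pullback_def
    by (intro conjI ballI impI ex) (assumption | simp)+
qed

context category
begin

lemma kernel_pair_jointly_monic:
  assumes "is_kernel_pair C f p q"
  shows "jointly_monic C p q"
proof -
  note k = kernel_pairD[OF assms]
  have "u = v" if z: "z \<in> Obj C" "u \<in> hom C z (Dom C p)" "v \<in> hom C z (Dom C p)"
    and e: "p \<cdot> u = p \<cdot> v" "q \<cdot> u = q \<cdot> v" for z u v
  proof -
    note uv = homD[OF z(2)] homD[OF z(3)]
    have "f \<cdot> (p \<cdot> u) = f \<cdot> (q \<cdot> u)"
      by (rule square_cmp) (use k uv in simp_all)
    moreover have "p \<cdot> u \<in> hom C z (Dom C f)" "q \<cdot> u \<in> hom C z (Dom C f)"
      using k uv by (simp_all add: hom_def cmp_Mor)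
    ultimately show ?thesis
      using kernel_pair_ex1[OF assms z(1), of "p \<cdot> u" "q \<cdot> u"] z(2,3) e by auto
  qed
  then show ?thesis
    using k by (simp add: jointly_monic_def)
qed

lemma kernel_pair_unique:
  assumes "is_kernel_pair C f p q" "is_kernel_pair C f p' q'"
  obtains i j where "i \<in> hom C (Dom C p) (Dom C p')" "j \<in> hom C (Dom C p') (Dom C p)"
    "i \<cdot> j = Ide C (Dom C p')" "p' \<cdot> i = p" "q' \<cdot> i = q"
proof -
  note k = kernel_pairD[OF assms(1)] and k' = kernel_pairD[OF assms(2)]
  obtain i where i: "i \<in> hom C (Dom C p) (Dom C p')" "p' \<cdot> i = p" "q' \<cdot> i = q"
    using kernel_pair_lift[OF assms(2), of "Dom C p" p q] k by (auto simp: hom_def dom_obj)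
  obtain j where j: "j \<in> hom C (Dom C p') (Dom C p)" "p \<cdot> j = p'" "q \<cdot> j = q'"
    using kernel_pair_lift[OF assms(1), of "Dom C p'" p' q'] k' by (auto simp: hom_def dom_obj)
  note ij = homD[OF i(1)] homD[OF j(1)]
  have "p' \<cdot> (i \<cdot> j) = p'" "q' \<cdot> (i \<cdot> j) = q'"
    using cmp_assoc[of j i p'] cmp_assoc[of j i q'] i j ij k' by auto
  then have "i \<cdot> j = Ide C (Dom C p')"
    using jointly_monicD[OF kernel_pair_jointly_monic[OF assms(2)], of "Dom C p'" "i \<cdot> j"] ij k'
    by (simp add: homI cat_simps)
  then show ?thesis using that i j by blast
qed

text \<open>The two halves of the isomorphism do different work:
  \<open>j \<cdot> i = Ide C k\<close> cancels \<open>i\<close> and gives joint monicity, while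
  \<open>i \<cdot> j = Ide C (Dom C p)\<close> turns a lift \<open>h\<close> through
  \<open>p\<close>, \<open>q\<close> into the lift \<open>j \<cdot> h\<close> through the
  transported pair.\<close>

lemma kernel_pair_transport:
  assumes "is_kernel_pair C f p q" and "i \<in> hom C k (Dom C p)" "j \<in> hom C (Dom C p) k"
    and "i \<cdot> j = Ide C (Dom C p)" "j \<cdot> i = Ide C k"
  shows "is_kernel_pair C f (p \<cdot> i) (q \<cdot> i)"
proof (rule kernel_pairI)
  note k = kernel_pairD[OF assms(1)]
  note ij = homD[OF assms(2)] homD[OF assms(3)]
  note [simp] = k(1-6) ij cat_simps
  show "f \<in> Mor C" "Cod C (p \<cdot> i) = Dom C f" "Cod C (q \<cdot> i) = Dom C f"
    by simp_all
  show "f \<cdot> (p \<cdot> i) = f \<cdot> (q \<cdot> i)"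
    by (rule square_cmp) (use k ij in simp_all)
  have inj: "u = v" if "z \<in> Obj C" "u \<in> hom C z k" "v \<in> hom C z k" "i \<cdot> u = i \<cdot> v" for z u v
  proof -
    note uv = homD[OF that(2)] homD[OF that(3)]
    have "(j \<cdot> i) \<cdot> u = (j \<cdot> i) \<cdot> v"
      using that(4) uv by simp
    then show ?thesis using assms(5) uv by simp
  qed
  show "jointly_monic C (p \<cdot> i) (q \<cdot> i)"
    unfolding jointly_monic_def
  proof (intro conjI ballI impI)
    fix z u v assume z: "z \<in> Obj C" and uv: "u \<in> hom C z (Dom C (p \<cdot> i))" "v \<in> hom C z (Dom C (p \<cdot> i))"
      and e: "p \<cdot> i \<cdot> u = p \<cdot> i \<cdot> v \<and> q \<cdot> i \<cdot> u = q \<cdot> i \<cdot> v"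
    note uv' = homD[OF uv(1)] homD[OF uv(2)]
    have "i \<cdot> u = i \<cdot> v"
      using jointly_monicD[OF kernel_pair_jointly_monic[OF assms(1)] z, of "i \<cdot> u" "i \<cdot> v"] e uv'
      by (simp add: hom_def)
    then show "u = v" using inj z uv by simp
  qed simp_all
  fix z u v assume z: "z \<in> Obj C" "u \<in> hom C z (Dom C f)" "v \<in> hom C z (Dom C f)" "f \<cdot> u = f \<cdot> v"
  obtain h where h: "h \<in> hom C z (Dom C p)" "p \<cdot> h = u" "q \<cdot> h = v"
    using kernel_pair_lift[OF assms(1) z] by blast
  note h' = homD[OF h(1)]
  have "i \<cdot> (j \<cdot> h) = h"
    using cmp_assoc[of h j i] assms(4) h' by simp
  then show "\<exists>h \<in> hom C z (Dom C (p \<cdot> i)). p \<cdot> i \<cdot> h = u \<and> q \<cdot> i \<cdot> h = v"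
    using h h' by (intro bexI[of _ "j \<cdot> h"]) (auto simp: hom_def)
qed

lemma kernel_pair_equivalence:
  assumes "is_kernel_pair C f p q"
  shows "equivalence_relation C p q"
proof -
  note k = kernel_pairD[OF assms]
  \<comment> \<open>On generalized elements a kernel pair is the relation of having equal image
    under \<open>f\<close>, which is visibly an equivalence.\<close>
  have "elem_rel C p q z = {(x, y) \<in> hom C z (Dom C f) \<times> hom C z (Dom C f). f \<cdot> x = f \<cdot> y}"
    if z: "z \<in> Obj C" for z
  proof -
    have "f \<cdot> (p \<cdot> h) = f \<cdot> (q \<cdot> h)" if "h \<in> hom C z (Dom C p)" for h
      by (rule square_cmp) (use k homD[OF that] in simp_all)
    moreover have "\<exists>h \<in> hom C z (Dom C p). x = p \<cdot> h \<and> y = q \<cdot> h"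
      if "x \<in> hom C z (Dom C f)" "y \<in> hom C z (Dom C f)" "f \<cdot> x = f \<cdot> y" for x y
      using kernel_pair_lift[OF assms z that] by blast
    moreover have "p \<cdot> h \<in> hom C z (Dom C f)" "q \<cdot> h \<in> hom C z (Dom C f)"
      if "h \<in> hom C z (Dom C p)" for h
      using k homD[OF that] by (simp_all add: hom_def cat_simps)
    ultimately show ?thesis
      unfolding elem_rel_def by blast
  qed
  then show ?thesis
    using k kernel_pair_jointly_monic[OF assms]
    by (auto simp: equivalence_relation_def equiv_def refl_on_def sym_def trans_def)
qed

end

subsection \<open>Full subcategories\<close>

lemma full_subcategory_simps [simp]:
  "Obj (full_subcategory C S) = Obj C \<inter> S"
  "Mor (full_subcategory C S) = {f \<in> Mor C. Dom C f \<in> S \<and> Cod C f \<in> S}"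
  "Dom (full_subcategory C S) = Dom C"
  "Cod (full_subcategory C S) = Cod C"
  "Ide (full_subcategory C S) = Ide C"
  "Cmp (full_subcategory C S) = Cmp C"
  by (simp_all add: full_subcategory_def)

lemma hom_full_subcategory:
  "hom (full_subcategory C S) a b = (if a \<in> S \<and> b \<in> S then hom C a b else {})"
  by (auto simp: hom_def)

lemma category_full_subcategory:
  assumes "category C"
  shows "category (full_subcategory C S)"
proof -
  interpret category C by fact
  show ?thesis
    by standard
      (auto simp: hom_full_subcategory dom_obj cod_obj ide_hom ide_left ide_right
        intro: assoc cmp_hom split: if_splits)
qed

text \<open>Lets a full subcategory that arises from some unspecified \<open>S\<close> be rewritten
  with its own objects as the defining set.\<close>

lemma full_subcategory_Obj:
  assumes "category C"
  shows "full_subcategory C (Obj C \<inter> S) = full_subcategory C S"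
  using category.dom_obj[OF assms] category.cod_obj[OF assms]
  unfolding full_subcategory_def
  by (intro arg_cong2[where f = "\<lambda>a b. C\<lparr>Obj := a, Mor := b\<rparr>"]) auto

lemma full_subcategory_full_subcategory:
  "full_subcategory (full_subcategory C S) T = full_subcategory C (S \<inter> T)"
  unfolding full_subcategory_def
  by (simp, intro arg_cong2[where f = "\<lambda>a b. C\<lparr>Obj := a, Mor := b\<rparr>"]) auto

text \<open>By fullness the lifts of the ambient category already belong to the subcategory, once
  the kernel object does.\<close>

lemma kernel_pair_full_subcategory:
  assumes "is_kernel_pair C f p q" "Dom C f \<in> S" "Cod C f \<in> S" "Dom C p \<in> S"
  shows "is_kernel_pair (full_subcategory C S) f p q"
  unfolding is_pullback_def full_subcategory_simps
proof (intro conjI ballI impI)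
  fix z u v
  assume z: "z \<in> Obj C \<inter> S" "f \<cdot>\<^bsub>C\<^esub> u = f \<cdot>\<^bsub>C\<^esub> v"
    and uv: "u \<in> hom (full_subcategory C S) z (Dom C f)" "v \<in> hom (full_subcategory C S) z (Dom C f)"
  have "u \<in> hom C z (Dom C f)" "v \<in> hom C z (Dom C f)"
    using uv z assms by (simp_all add: hom_full_subcategory)
  from kernel_pair_ex1[OF assms(1) _ this z(2)] z(1) assms(4)
  show "\<exists>!h. h \<in> hom (full_subcategory C S) z (Dom C p) \<and> p \<cdot>\<^bsub>C\<^esub> h = u \<and> q \<cdot>\<^bsub>C\<^esub> h = v"
    by (simp add: hom_full_subcategory)
qed (use assms kernel_pairD[OF assms(1)] in simp_all)

lemma isomorphic_full_subcategory:
  assumes "a \<in> S" "b \<in> S"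
  shows "isomorphic (full_subcategory C S) a b \<longleftrightarrow> isomorphic C a b"
  using assms by (simp add: isomorphic_def hom_full_subcategory)

lemma reflexive_graph_full_subcategory:
  "reflexive_graph (full_subcategory C S) d c s \<longleftrightarrow>
    reflexive_graph C d c s \<and> Dom C d \<in> S \<and> Cod C d \<in> S"
  by (auto simp: reflexive_graph_def hom_full_subcategory split: if_splits)

lemma RGrph_full_subcategory:
  "RGrph (full_subcategory C S) =
    full_subcategory (RGrph C) {G. Dom C (gdom G) \<in> S \<and> Cod C (gdom G) \<in> S}"
  unfolding RGrph_def reflexive_graph_full_subcategory
  by (auto simp: full_subcategory_def hom_def)

text \<open>The equivalence condition stays relative to the subcategory: it is tested on generalized
  elements with domain in \<open>S\<close> and is a priori weaker than the condition in
  \<open>C\<close>.\<close>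

lemma ERel_full_subcategory:
  "ERel (full_subcategory C S) = full_subcategory (RGrph C)
    {G. Dom C (gdom G) \<in> S \<and> Cod C (gdom G) \<in> S
        \<and> equivalence_relation (full_subcategory C S) (gdom G) (gcod G)}"
  unfolding ERel_def RGrph_full_subcategory full_subcategory_full_subcategory
  by (rule arg_cong[where f = "full_subcategory (RGrph C)"]) auto

subsection \<open>Arrow categories and categories of reflexive graphs\<close>

lemma Arr_simps [simp]:
  "Obj (Arr C) = Mor C" "Dom (Arr C) = source" "Cod (Arr C) = target"
  "Ide (Arr C) f = Map f f (Ide C (Dom C f)) (Ide C (Cod C f))"
  "k \<cdot>\<^bsub>Arr C\<^esub> h = Map (source h) (target k) (upper k \<cdot>\<^bsub>C\<^esub> upper h) (lower k \<cdot>\<^bsub>C\<^esub> lower h)"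
  by (simp_all add: Arr_def)

lemma RGrph_simps [simp]:
  "Dom (RGrph C) = source" "Cod (RGrph C) = target"
  "Ide (RGrph C) G = Map G G (Ide C (Dom C (gdom G))) (Ide C (Cod C (gdom G)))"
  "k \<cdot>\<^bsub>RGrph C\<^esub> h = Map (source h) (target k) (upper k \<cdot>\<^bsub>C\<^esub> upper h) (lower k \<cdot>\<^bsub>C\<^esub> lower h)"
  by (simp_all add: RGrph_def)

lemma Arr_homI:
  assumes "f \<in> Mor C" "g \<in> Mor C" "u \<in> hom C (Dom C f) (Dom C g)"
    "l \<in> hom C (Cod C f) (Cod C g)" "l \<cdot>\<^bsub>C\<^esub> f = g \<cdot>\<^bsub>C\<^esub> u"
  shows "Map f g u l \<in> hom (Arr C) f g"
  using assms by (simp add: hom_def Arr_def)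

lemma Arr_homD:
  assumes "h \<in> hom (Arr C) f g"
  shows "f \<in> Mor C" "g \<in> Mor C" "h = Map f g (upper h) (lower h)"
    "upper h \<in> Mor C" "Dom C (upper h) = Dom C f" "Cod C (upper h) = Dom C g"
    "lower h \<in> Mor C" "Dom C (lower h) = Cod C f" "Cod C (lower h) = Cod C g"
    "lower h \<cdot>\<^bsub>C\<^esub> f = g \<cdot>\<^bsub>C\<^esub> upper h"
  using assms by (auto simp: hom_def Arr_def)

lemma reflexive_graphD:
  assumes "reflexive_graph C d c s"
  shows "d \<in> Mor C" "c \<in> Mor C" "s \<in> Mor C" "Dom C c = Dom C d" "Cod C c = Cod C d"
    "Dom C s = Cod C d" "Cod C s = Dom C d"
    "d \<cdot>\<^bsub>C\<^esub> s = Ide C (Cod C d)" "c \<cdot>\<^bsub>C\<^esub> s = Ide C (Cod C d)"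
  using assms by (auto simp: reflexive_graph_def hom_def)

lemma reflexive_graphI:
  assumes "d \<in> Mor C" "c \<in> Mor C" "s \<in> Mor C" "Dom C c = Dom C d" "Cod C c = Cod C d"
    "Dom C s = Cod C d" "Cod C s = Dom C d"
    "d \<cdot>\<^bsub>C\<^esub> s = Ide C (Cod C d)" "c \<cdot>\<^bsub>C\<^esub> s = Ide C (Cod C d)"
  shows "reflexive_graph C d c s"
  using assms by (auto simp: reflexive_graph_def hom_def)

lemma RGrph_Obj_iff: "Graph d c s \<in> Obj (RGrph C) \<longleftrightarrow> reflexive_graph C d c s"
  by (simp add: RGrph_def)

lemma RGrph_ObjD:
  assumes "G \<in> Obj (RGrph C)"
  shows "G = Graph (gdom G) (gcod G) (gunit G)" "reflexive_graph C (gdom G) (gcod G) (gunit G)"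
  using assms by (auto simp: RGrph_def)

lemma RGrph_homI:
  assumes "G \<in> Obj (RGrph C)" "H \<in> Obj (RGrph C)"
    "u \<in> hom C (Dom C (gdom G)) (Dom C (gdom H))" "l \<in> hom C (Cod C (gdom G)) (Cod C (gdom H))"
    "gdom H \<cdot>\<^bsub>C\<^esub> u = l \<cdot>\<^bsub>C\<^esub> gdom G" "gcod H \<cdot>\<^bsub>C\<^esub> u = l \<cdot>\<^bsub>C\<^esub> gcod G"
    "gunit H \<cdot>\<^bsub>C\<^esub> l = u \<cdot>\<^bsub>C\<^esub> gunit G"
  shows "Map G H u l \<in> hom (RGrph C) G H"
  using assms by (auto simp: hom_def RGrph_def)

lemma RGrph_homD:
  assumes "h \<in> hom (RGrph C) G H"
  shows "G \<in> Obj (RGrph C)" "H \<in> Obj (RGrph C)" "h = Map G H (upper h) (lower h)"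
    "upper h \<in> Mor C" "Dom C (upper h) = Dom C (gdom G)" "Cod C (upper h) = Dom C (gdom H)"
    "lower h \<in> Mor C" "Dom C (lower h) = Cod C (gdom G)" "Cod C (lower h) = Cod C (gdom H)"
    "gdom H \<cdot>\<^bsub>C\<^esub> upper h = lower h \<cdot>\<^bsub>C\<^esub> gdom G" "gcod H \<cdot>\<^bsub>C\<^esub> upper h = lower h \<cdot>\<^bsub>C\<^esub> gcod G"
    "gunit H \<cdot>\<^bsub>C\<^esub> lower h = upper h \<cdot>\<^bsub>C\<^esub> gunit G"
  using assms by (auto simp: hom_def RGrph_def)

lemma RGrph_eqI:
  assumes "h \<in> hom (RGrph C) G H" "k \<in> hom (RGrph C) G H" "upper h = upper k" "lower h = lower k"
  shows "h = k"
  using RGrph_homD(3)[OF assms(1)] RGrph_homD(3)[OF assms(2)] assms(3,4) by metis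

lemma Mor_RGrph_hom: "m \<in> Mor (RGrph C) \<Longrightarrow> m \<in> hom (RGrph C) (source m) (target m)"
  by (simp add: hom_def)

locale cells = category C for C :: "(('o, 'm) cell, ('o, 'm) cell) category" (structure)
begin

lemma category_Arr: "category (Arr C)"
proof -
  show ?thesis
  proof
    fix f assume "f \<in> Mor (Arr C)"
    then have "f \<in> hom (Arr C) (source f) (target f)" by (simp add: hom_def)
    from Arr_homD(1,2)[OF this]
    show "Dom (Arr C) f \<in> Obj (Arr C)" "Cod (Arr C) f \<in> Obj (Arr C)" by simp_all
  next
    fix a assume "a \<in> Obj (Arr C)"
    then show "Ide (Arr C) a \<in> hom (Arr C) a a"
      unfolding Arr_simps by (intro Arr_homI) (simp_all add: hom_def cat_simps)
  next
    fix f g a b c assume f: "f \<in> hom (Arr C) a b" and g: "g \<in> hom (Arr C) b c"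
    note fD = Arr_homD[OF f] and gD = Arr_homD[OF g]
    have "(lower g \<cdot> lower f) \<cdot> a = lower g \<cdot> (b \<cdot> upper f)"
      using fD gD by (simp add: cat_simps)
    also have "\<dots> = c \<cdot> (upper g \<cdot> upper f)"
      by (rule square_cmp) (use fD(1-9) gD in simp_all)
    finally have "Map a c (upper g \<cdot> upper f) (lower g \<cdot> lower f) \<in> hom (Arr C) a c"
      using fD(1-9) gD(1-9) by (intro Arr_homI) (simp_all add: hom_def cat_simps)
    then show "g \<cdot>\<^bsub>Arr C\<^esub> f \<in> hom (Arr C) a c"
      using f g by (simp add: hom_def)
  next
    fix f a b assume f: "f \<in> hom (Arr C) a b"
    note fD = Arr_homD[OF f]
    show "f \<cdot>\<^bsub>Arr C\<^esub> Ide (Arr C) a = f" "Ide (Arr C) b \<cdot>\<^bsub>Arr C\<^esub> f = f"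
      by (subst (2) fD(3), use f fD(4-9) in \<open>simp add: hom_def cat_simps\<close>)+
  next
    fix f g h a b c d
    assume f: "f \<in> hom (Arr C) a b" and g: "g \<in> hom (Arr C) b c" and h: "h \<in> hom (Arr C) c d"
    show "h \<cdot>\<^bsub>Arr C\<^esub> (g \<cdot>\<^bsub>Arr C\<^esub> f) = h \<cdot>\<^bsub>Arr C\<^esub> g \<cdot>\<^bsub>Arr C\<^esub> f"
      using Arr_homD(4-9)[OF f] Arr_homD(4-9)[OF g] Arr_homD(4-9)[OF h]
      by (simp add: cmp_assoc)
  qed
qed

lemma category_RGrph: "category (RGrph C)"
proof -
  show ?thesis
  proof
    fix f assume "f \<in> Mor (RGrph C)"
    from RGrph_homD(1,2)[OF Mor_RGrph_hom[OF this]]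
    show "Dom (RGrph C) f \<in> Obj (RGrph C)" "Cod (RGrph C) f \<in> Obj (RGrph C)" by simp_all
  next
    fix a assume "a \<in> Obj (RGrph C)"
    with reflexive_graphD(1-7)[OF RGrph_ObjD(2)[OF this]]
    show "Ide (RGrph C) a \<in> hom (RGrph C) a a"
      unfolding RGrph_simps by (intro RGrph_homI) (simp_all add: hom_def cat_simps)
  next
    fix f g a b c assume f: "f \<in> hom (RGrph C) a b" and g: "g \<in> hom (RGrph C) b c"
    note fD = RGrph_homD[OF f] and gD = RGrph_homD[OF g]
    note D = fD(4-9) gD(4-9) and aD = reflexive_graphD(1-7)[OF RGrph_ObjD(2)[OF fD(1)]]
      and bD = reflexive_graphD(1-7)[OF RGrph_ObjD(2)[OF gD(1)]]
      and cD = reflexive_graphD(1-7)[OF RGrph_ObjD(2)[OF gD(2)]]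
    have "gdom c \<cdot> (upper g \<cdot> upper f) = lower g \<cdot> (gdom b \<cdot> upper f)"
      by (rule square_cmp[OF gD(10)]) (use D aD bD cD in simp_all)
    then have 1: "gdom c \<cdot> (upper g \<cdot> upper f) = (lower g \<cdot> lower f) \<cdot> gdom a"
      using D aD by (simp add: fD(10) cat_simps)
    have "gcod c \<cdot> (upper g \<cdot> upper f) = lower g \<cdot> (gcod b \<cdot> upper f)"
      by (rule square_cmp[OF gD(11)]) (use D aD bD cD in simp_all)
    then have 2: "gcod c \<cdot> (upper g \<cdot> upper f) = (lower g \<cdot> lower f) \<cdot> gcod a"
      using D aD by (simp add: fD(11) cat_simps)
    have "gunit c \<cdot> (lower g \<cdot> lower f) = upper g \<cdot> (gunit b \<cdot> lower f)"
      by (rule square_cmp[OF gD(12)]) (use D aD bD cD in simp_all)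
    then have 3: "gunit c \<cdot> (lower g \<cdot> lower f) = (upper g \<cdot> upper f) \<cdot> gunit a"
      using D aD by (simp add: fD(12) cat_simps)
    have "Map a c (upper g \<cdot> upper f) (lower g \<cdot> lower f) \<in> hom (RGrph C) a c"
      by (rule RGrph_homI[OF fD(1) gD(2) _ _ 1 2 3]) (use D in \<open>simp_all add: hom_def cat_simps\<close>)
    then show "g \<cdot>\<^bsub>RGrph C\<^esub> f \<in> hom (RGrph C) a c"
      using f g by (simp add: hom_def)
  next
    fix f a b assume f: "f \<in> hom (RGrph C) a b"
    note fD = RGrph_homD[OF f]
    show "f \<cdot>\<^bsub>RGrph C\<^esub> Ide (RGrph C) a = f" "Ide (RGrph C) b \<cdot>\<^bsub>RGrph C\<^esub> f = f"
      by (subst (2) fD(3), use f fD(4-9) in \<open>simp add: hom_def cat_simps\<close>)+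
  next
    fix f g h a b c d
    assume f: "f \<in> hom (RGrph C) a b" and g: "g \<in> hom (RGrph C) b c" and h: "h \<in> hom (RGrph C) c d"
    show "h \<cdot>\<^bsub>RGrph C\<^esub> (g \<cdot>\<^bsub>RGrph C\<^esub> f) = h \<cdot>\<^bsub>RGrph C\<^esub> g \<cdot>\<^bsub>RGrph C\<^esub> f"
      using RGrph_homD(4-9)[OF f] RGrph_homD(4-9)[OF g] RGrph_homD(4-9)[OF h]
      by (simp add: cmp_assoc)
  qed
qed

end

subsection \<open>Kernel pairs of morphisms of reflexive graphs\<close>

context cells
begin

text \<open>The kernel pairs of the two components are joined into a graph by their universal
  properties: domain and codomain maps are lifts into the lower one, the unit is a lift into the
  upper one. All required equations are checked after the jointly monic projections. The components
  are exported with the kernel pair because an arbitrary kernel pair is later compared with this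
  one.\<close>

lemma RGrph_kernel_pair_exists:
  assumes "has_kernel_pairs C" "m \<in> Mor (RGrph C)"
  obtains P Q where "is_kernel_pair (RGrph C) m P Q"
    "is_kernel_pair C (upper m) (upper P) (upper Q)" "is_kernel_pair C (lower m) (lower P) (lower Q)"
proof -
  interpret G: category "RGrph C" by (rule category_RGrph)
  define A B where "A = source m" and "B = target m"
  define u l where "u = upper m" and "l = lower m"
  define d c s where "d = gdom A" and "c = gcod A" and "s = gunit A"
  have m: "m \<in> hom (RGrph C) A B"
    using assms(2) by (simp add: A_def B_def Mor_RGrph_hom)
  note mD = RGrph_homD[OF m, folded d_def c_def s_def u_def l_def]
  note AD = reflexive_graphD[OF RGrph_ObjD(2)[OF mD(1)], folded d_def c_def s_def]
  note BD = reflexive_graphD[OF RGrph_ObjD(2)[OF mD(2)]]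
  obtain p1 q1 where k1: "is_kernel_pair C u p1 q1"
    using assms(1) mD(4) by (auto simp: has_kernel_pairs_def)
  obtain p0 q0 where k0: "is_kernel_pair C l p0 q0"
    using assms(1) mD(7) by (auto simp: has_kernel_pairs_def)
  note D1 = kernel_pairD[OF k1] and D0 = kernel_pairD[OF k0]
  note jm1 = kernel_pair_jointly_monic[OF k1] and jm0 = kernel_pair_jointly_monic[OF k0]
  note ty = mD(4-9) AD(1-7) BD(1-7) D1(1-6) D0(1-6)

  \<comment> \<open>Stated for a square \<open>y \<cdot> u = l \<cdot> x\<close> so that it serves
    twice: \<open>x\<close>, \<open>y\<close> are the two domain maps, then the two codomain
    maps.\<close>
  have edge: "\<exists>e. e \<in> hom C (Dom C p1) (Dom C p0) \<and> p0 \<cdot> e = x \<cdot> p1 \<and> q0 \<cdot> e = x \<cdot> q1"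
    if x: "x \<in> Mor C" "Dom C x = Dom C d" "Cod C x = Cod C d"
      and y: "y \<in> Mor C" "Dom C y = Dom C (gdom B)" "Cod C y = Cod C (gdom B)" "y \<cdot> u = l \<cdot> x" for x y
  proof -
    have "l \<cdot> (x \<cdot> p1) = y \<cdot> (u \<cdot> p1)"
      by (rule square_cmp[OF y(4)[symmetric]]) (use x y(1-3) ty in simp_all)
    also have "\<dots> = y \<cdot> (u \<cdot> q1)"
      using D1(7) by simp
    also have "\<dots> = l \<cdot> (x \<cdot> q1)"
      by (rule square_cmp[OF y(4)]) (use x y(1-3) ty in simp_all)
    finally have e: "l \<cdot> (x \<cdot> p1) = l \<cdot> (x \<cdot> q1)" .
    obtain h where "h \<in> hom C (Dom C p1) (Dom C p0)" "p0 \<cdot> h = x \<cdot> p1" "q0 \<cdot> h = x \<cdot> q1"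
      by (rule kernel_pair_lift[OF k0 _ _ _ e, of "Dom C p1"])
        (use x ty in \<open>simp_all add: hom_def cat_simps\<close>)
    then show ?thesis by blast
  qed
  obtain dK where dK: "dK \<in> hom C (Dom C p1) (Dom C p0)" "p0 \<cdot> dK = d \<cdot> p1" "q0 \<cdot> dK = d \<cdot> q1"
    using edge[of d "gdom B"] ty mD(10) by auto
  obtain cK where cK: "cK \<in> hom C (Dom C p1) (Dom C p0)" "p0 \<cdot> cK = c \<cdot> p1" "q0 \<cdot> cK = c \<cdot> q1"
    using edge[of c "gcod B"] ty mD(11) by auto
  have e: "u \<cdot> (s \<cdot> p0) = u \<cdot> (s \<cdot> q0)"
  proof -
    have "u \<cdot> (s \<cdot> p0) = gunit B \<cdot> (l \<cdot> p0)"
      by (rule square_cmp[OF mD(12)[symmetric]]) (use ty in simp_all)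
    also have "\<dots> = gunit B \<cdot> (l \<cdot> q0)"
      using D0(7) by simp
    also have "\<dots> = u \<cdot> (s \<cdot> q0)"
      by (rule square_cmp[OF mD(12)]) (use ty in simp_all)
    finally show ?thesis .
  qed
  obtain sK where sK: "sK \<in> hom C (Dom C p0) (Dom C p1)" "p1 \<cdot> sK = s \<cdot> p0" "q1 \<cdot> sK = s \<cdot> q0"
    by (rule kernel_pair_lift[OF k1 _ _ _ e, of "Dom C p0"])
      (use ty in \<open>simp_all add: hom_def cat_simps\<close>)

  \<comment> \<open>Again for both structure maps: \<open>e\<close> is \<open>dK\<close> over
    \<open>x = d\<close>, or \<open>cK\<close> over \<open>x = c\<close>.\<close>
  have unit: "e \<cdot> sK = Ide C (Dom C p0)"
    if e: "e \<in> hom C (Dom C p1) (Dom C p0)" "p0 \<cdot> e = x \<cdot> p1" "q0 \<cdot> e = x \<cdot> q1"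
      and x: "x \<in> Mor C" "Dom C x = Dom C d" "Cod C x = Cod C d" "x \<cdot> s = Ide C (Cod C d)" for e x
  proof (rule jointly_monicD[OF jm0, of "Dom C p0"])
    note t = homD[OF e(1)] homD[OF sK(1)] x(1-3) ty
    have "p0 \<cdot> (e \<cdot> sK) = x \<cdot> (p1 \<cdot> sK)"
      by (rule square_cmp[OF e(2)]) (use t in simp_all)
    also have "\<dots> = (x \<cdot> s) \<cdot> p0"
      unfolding sK(2) by (rule cmp_assoc[symmetric]) (use t in simp_all)
    finally show "p0 \<cdot> (e \<cdot> sK) = p0 \<cdot> Ide C (Dom C p0)"
      using x(4) t by (simp add: cat_simps)
    have "q0 \<cdot> (e \<cdot> sK) = x \<cdot> (q1 \<cdot> sK)"
      by (rule square_cmp[OF e(3)]) (use t in simp_all)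
    also have "\<dots> = (x \<cdot> s) \<cdot> q0"
      unfolding sK(3) by (rule cmp_assoc[symmetric]) (use t in simp_all)
    finally show "q0 \<cdot> (e \<cdot> sK) = q0 \<cdot> Ide C (Dom C p0)"
      using x(4) t by (simp add: cat_simps)
  qed (use homD[OF e(1)] homD[OF sK(1)] ty in \<open>simp_all add: hom_def cat_simps\<close>)

  define K where "K = Graph dK cK sK"
  note Kt = homD[OF dK(1)] homD[OF cK(1)] homD[OF sK(1)]
  have K: "K \<in> Obj (RGrph C)"
    unfolding K_def RGrph_Obj_iff
    by (rule reflexive_graphI)
      (use Kt unit[OF dK] unit[OF cK] ty AD(8,9) in \<open>simp_all\<close>)
  have Ksel [simp]: "gdom K = dK" "gcod K = cK" "gunit K = sK"
    by (simp_all add: K_def)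
  define P Q where "P = Map K A p1 p0" and "Q = Map K A q1 q0"
  have P: "P \<in> hom (RGrph C) K A"
    unfolding P_def by (rule RGrph_homI[OF K mD(1)], unfold Ksel)
      (use Kt dK cK sK ty in \<open>simp_all add: hom_def d_def c_def s_def\<close>)
  have Q: "Q \<in> hom (RGrph C) K A"
    unfolding Q_def by (rule RGrph_homI[OF K mD(1)], unfold Ksel)
      (use Kt dK cK sK ty in \<open>simp_all add: hom_def d_def c_def s_def\<close>)
  have [simp]: "source P = K" "target P = A" "upper P = p1" "lower P = p0"
    "source Q = K" "target Q = A" "upper Q = q1" "lower Q = q0"
    by (simp_all add: P_def Q_def)

  have jm: "jointly_monic (RGrph C) P Q"
    unfolding jointly_monic_def
  proof (intro conjI ballI impI)
    fix Z U V
    assume "Z \<in> Obj (RGrph C)" and "U \<in> hom (RGrph C) Z (Dom (RGrph C) P)"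
      and "V \<in> hom (RGrph C) Z (Dom (RGrph C) P)"
      and e: "P \<cdot>\<^bsub>RGrph C\<^esub> U = P \<cdot>\<^bsub>RGrph C\<^esub> V \<and> Q \<cdot>\<^bsub>RGrph C\<^esub> U = Q \<cdot>\<^bsub>RGrph C\<^esub> V"
    then have U: "U \<in> hom (RGrph C) Z K" and V: "V \<in> hom (RGrph C) Z K"
      by simp_all
    note UD = RGrph_homD(4-9)[OF U] and VD = RGrph_homD(4-9)[OF V]
    have Zt: "Dom C (gdom Z) \<in> Obj C" "Cod C (gdom Z) \<in> Obj C"
      using UD dom_obj by metis+
    have "upper U = upper V"
      by (rule jointly_monicD[OF jm1 Zt(1)]) (use UD VD e Kt in \<open>simp_all add: hom_def\<close>)
    moreover have "lower U = lower V"
      by (rule jointly_monicD[OF jm0 Zt(2)]) (use UD VD e Kt in \<open>simp_all add: hom_def\<close>)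
    ultimately show "U = V"
      using U V by (rule RGrph_eqI[rotated 2])
  qed (use P Q in \<open>auto simp: hom_def\<close>)
  have "is_kernel_pair (RGrph C) m P Q"
  proof (rule kernel_pairI[OF assms(2) jm])
    show "m \<cdot>\<^bsub>RGrph C\<^esub> P = m \<cdot>\<^bsub>RGrph C\<^esub> Q"
      using D1(7) D0(7) by (simp add: u_def l_def)
    fix Z U V
    assume Z: "Z \<in> Obj (RGrph C)" and "U \<in> hom (RGrph C) Z (Dom (RGrph C) m)"
      and "V \<in> hom (RGrph C) Z (Dom (RGrph C) m)" and e: "m \<cdot>\<^bsub>RGrph C\<^esub> U = m \<cdot>\<^bsub>RGrph C\<^esub> V"
    then have U: "U \<in> hom (RGrph C) Z A" and V: "V \<in> hom (RGrph C) Z A"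
      by (simp_all add: A_def)
    note UD = RGrph_homD[OF U, folded d_def c_def s_def] and VD = RGrph_homD[OF V, folded d_def c_def s_def]
    note ZD = reflexive_graphD[OF RGrph_ObjD(2)[OF UD(1)]]
    have Zt: "Dom C (gdom Z) \<in> Obj C" "Cod C (gdom Z) \<in> Obj C"
      using UD dom_obj by metis+
    obtain h1 where h1: "h1 \<in> hom C (Dom C (gdom Z)) (Dom C p1)" "p1 \<cdot> h1 = upper U" "q1 \<cdot> h1 = upper V"
      by (rule kernel_pair_lift[OF k1 Zt(1), of "upper U" "upper V"])
        (use UD(4-9) VD(4-9) e ty in \<open>simp_all add: hom_def u_def\<close>)
    obtain h0 where h0: "h0 \<in> hom C (Cod C (gdom Z)) (Dom C p0)" "p0 \<cdot> h0 = lower U" "q0 \<cdot> h0 = lower V"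
      by (rule kernel_pair_lift[OF k0 Zt(2), of "lower U" "lower V"])
        (use UD(4-9) VD(4-9) e ty in \<open>simp_all add: hom_def l_def\<close>)
    note ht = homD[OF h1(1)] homD[OF h0(1)]
    \<comment> \<open>The componentwise lifts \<open>h1\<close> and \<open>h0\<close> form a
      morphism of graphs; \<open>z\<close> stands for the domain or the codomain map of
      \<open>Z\<close>. Compatibility with the units is checked separately in \<open>squ\<close>,
      against the upper kernel pair.\<close>
    have sq: "e \<cdot> h1 = h0 \<cdot> z"
      if e: "e \<in> hom C (Dom C p1) (Dom C p0)" "p0 \<cdot> e = x \<cdot> p1" "q0 \<cdot> e = x \<cdot> q1"
        and x: "x \<in> Mor C" "Dom C x = Dom C d" "Cod C x = Cod C d"
        and z: "z \<in> Mor C" "Dom C z = Dom C (gdom Z)" "Cod C z = Cod C (gdom Z)"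
        "x \<cdot> upper U = lower U \<cdot> z" "x \<cdot> upper V = lower V \<cdot> z" for e x z
    proof (rule jointly_monicD[OF jm0 Zt(1)])
      note t = homD[OF e(1)] ht x(1-3) z(1-3) ty
      have "p0 \<cdot> (e \<cdot> h1) = x \<cdot> (p1 \<cdot> h1)"
        by (rule square_cmp[OF e(2)]) (use t in simp_all)
      also have "\<dots> = p0 \<cdot> (h0 \<cdot> z)"
        unfolding h1(2) z(4) h0(2)[symmetric] by (rule cmp_assoc) (use t in simp_all)
      finally show "p0 \<cdot> (e \<cdot> h1) = p0 \<cdot> (h0 \<cdot> z)" .
      have "q0 \<cdot> (e \<cdot> h1) = x \<cdot> (q1 \<cdot> h1)"
        by (rule square_cmp[OF e(3)]) (use t in simp_all)
      also have "\<dots> = q0 \<cdot> (h0 \<cdot> z)"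
        unfolding h1(3) z(5) h0(3)[symmetric] by (rule cmp_assoc) (use t in simp_all)
      finally show "q0 \<cdot> (e \<cdot> h1) = q0 \<cdot> (h0 \<cdot> z)" .
    qed (use homD[OF e(1)] ht z(1-3) ty in \<open>simp_all add: hom_def cat_simps\<close>)
    have sqd: "dK \<cdot> h1 = h0 \<cdot> gdom Z"
      by (rule sq[OF dK]) (use ty ZD UD(10) VD(10) in simp_all)
    have sqc: "cK \<cdot> h1 = h0 \<cdot> gcod Z"
      by (rule sq[OF cK]) (use ty ZD UD(11) VD(11) in simp_all)
    have squ: "sK \<cdot> h0 = h1 \<cdot> gunit Z"
    proof (rule jointly_monicD[OF jm1 Zt(2)])
      note t = ht ZD(1-7) Kt ty
      have "p1 \<cdot> (sK \<cdot> h0) = s \<cdot> (p0 \<cdot> h0)"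
        by (rule square_cmp[OF sK(2)]) (use t in simp_all)
      also have "\<dots> = p1 \<cdot> (h1 \<cdot> gunit Z)"
        unfolding h0(2) UD(12) h1(2)[symmetric] by (rule cmp_assoc) (use t in simp_all)
      finally show "p1 \<cdot> (sK \<cdot> h0) = p1 \<cdot> (h1 \<cdot> gunit Z)" .
      have "q1 \<cdot> (sK \<cdot> h0) = s \<cdot> (q0 \<cdot> h0)"
        by (rule square_cmp[OF sK(3)]) (use t in simp_all)
      also have "\<dots> = q1 \<cdot> (h1 \<cdot> gunit Z)"
        unfolding h0(3) VD(12) h1(3)[symmetric] by (rule cmp_assoc) (use t in simp_all)
      finally show "q1 \<cdot> (sK \<cdot> h0) = q1 \<cdot> (h1 \<cdot> gunit Z)" .
    qed (use ht ZD(1-7) Kt ty in \<open>simp_all add: hom_def cat_simps\<close>)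
    have "Map Z K h1 h0 \<in> hom (RGrph C) Z K"
      by (rule RGrph_homI[OF Z K], unfold Ksel) (use ht Kt sqd sqc squ in \<open>simp_all add: hom_def\<close>)
    moreover have "P \<cdot>\<^bsub>RGrph C\<^esub> Map Z K h1 h0 = U" "Q \<cdot>\<^bsub>RGrph C\<^esub> Map Z K h1 h0 = V"
      using UD(3)[symmetric] VD(3)[symmetric] by (simp_all add: h1(2,3) h0(2,3))
    ultimately show "\<exists>h \<in> hom (RGrph C) Z (Dom (RGrph C) P). P \<cdot>\<^bsub>RGrph C\<^esub> h = U \<and> Q \<cdot>\<^bsub>RGrph C\<^esub> h = V"
      using bexI[of "\<lambda>h. P \<cdot>\<^bsub>RGrph C\<^esub> h = U \<and> Q \<cdot>\<^bsub>RGrph C\<^esub> h = V" "Map Z K h1 h0"]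
      unfolding RGrph_simps(1) \<open>source P = K\<close> by blast
  qed (simp_all add: A_def)
  then show ?thesis
    by (rule that) (use k1 k0 in \<open>simp_all add: u_def l_def\<close>)
qed

lemma has_kernel_pairs_RGrph:
  assumes "has_kernel_pairs C"
  shows "has_kernel_pairs (RGrph C)"
  using RGrph_kernel_pair_exists[OF assms] unfolding has_kernel_pairs_def by metis

text \<open>Any kernel pair is isomorphic to the levelwise one, and an isomorphism of graphs is an
  isomorphism in each component, so the components are transported.\<close>

lemma RGrph_kernel_pair_components:
  assumes "has_kernel_pairs C" and k: "is_kernel_pair (RGrph C) m P Q"
  shows "is_kernel_pair C (upper m) (upper P) (upper Q)" "is_kernel_pair C (lower m) (lower P) (lower Q)"
proof -
  interpret G: category "RGrph C" by (rule category_RGrph)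
  note kD = kernel_pairD[OF k]
  obtain P' Q' where k': "is_kernel_pair (RGrph C) m P' Q'"
    and k1: "is_kernel_pair C (upper m) (upper P') (upper Q')"
    and k0: "is_kernel_pair C (lower m) (lower P') (lower Q')"
    using RGrph_kernel_pair_exists[OF assms(1) kD(1)] .
  note kD' = kernel_pairD[OF k']
  obtain i j where i: "i \<in> hom (RGrph C) (source P) (source P')" and j: "j \<in> hom (RGrph C) (source P') (source P)"
    and ij: "i \<cdot>\<^bsub>RGrph C\<^esub> j = Ide (RGrph C) (source P')"
    and e: "P' \<cdot>\<^bsub>RGrph C\<^esub> i = P" "Q' \<cdot>\<^bsub>RGrph C\<^esub> i = Q"
    using G.kernel_pair_unique[OF k k'] unfolding RGrph_simps(1) .
  \<comment> \<open>The uniqueness lemma delivers only \<open>i\<close> after \<open>j\<close>. The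
    other composite is the identity because \<open>P\<close> and \<open>Q\<close> are jointly monic:
    composing either one with \<open>j\<close> gives \<open>P'\<close> or \<open>Q'\<close>, and
    then \<open>i\<close> leads back.\<close>
  have ji: "j \<cdot>\<^bsub>RGrph C\<^esub> i = Ide (RGrph C) (source P)"
  proof (rule jointly_monicD[OF G.kernel_pair_jointly_monic[OF k], of "source P"])
    note t = homD[OF i, simplified] homD[OF j, simplified] kD(2-6) kD'(2-6)
    have r: "R \<cdot>\<^bsub>RGrph C\<^esub> (j \<cdot>\<^bsub>RGrph C\<^esub> i) = R \<cdot>\<^bsub>RGrph C\<^esub> Ide (RGrph C) (source P)"
      if R': "R' \<cdot>\<^bsub>RGrph C\<^esub> i = R" and R: "R \<in> Mor (RGrph C)" "R' \<in> Mor (RGrph C)"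
      "Dom (RGrph C) R = source P" "Dom (RGrph C) R' = source P'" for R R'
    proof -
      have "R \<cdot>\<^bsub>RGrph C\<^esub> j = R' \<cdot>\<^bsub>RGrph C\<^esub> (i \<cdot>\<^bsub>RGrph C\<^esub> j)"
        unfolding R'[symmetric] by (rule G.cmp_assoc) (use t R in simp_all)
      then have "R \<cdot>\<^bsub>RGrph C\<^esub> j = R'"
        unfolding ij using G.cmp_ide(2)[OF R(2,4)] by simp
      moreover have "(R \<cdot>\<^bsub>RGrph C\<^esub> j) \<cdot>\<^bsub>RGrph C\<^esub> i = R \<cdot>\<^bsub>RGrph C\<^esub> (j \<cdot>\<^bsub>RGrph C\<^esub> i)"
        by (rule G.cmp_assoc) (use t R in simp_all)
      ultimately show ?thesis
        using R' G.cmp_ide(2)[OF R(1,3)] by simp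
    qed
    show "P \<cdot>\<^bsub>RGrph C\<^esub> (j \<cdot>\<^bsub>RGrph C\<^esub> i) = P \<cdot>\<^bsub>RGrph C\<^esub> Ide (RGrph C) (source P)"
      by (rule r[OF e(1)]) (use t in simp_all)
    show "Q \<cdot>\<^bsub>RGrph C\<^esub> (j \<cdot>\<^bsub>RGrph C\<^esub> i) = Q \<cdot>\<^bsub>RGrph C\<^esub> Ide (RGrph C) (source P)"
      by (rule r[OF e(2)]) (use t in simp_all)
    show "source P \<in> Obj (RGrph C)"
      using RGrph_homD(1)[OF i] .
    then show "Ide (RGrph C) (source P) \<in> hom (RGrph C) (source P) (Dom (RGrph C) P)"
      unfolding RGrph_simps(1) by (rule G.ide_hom)
    show "j \<cdot>\<^bsub>RGrph C\<^esub> i \<in> hom (RGrph C) (source P) (Dom (RGrph C) P)"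
      unfolding RGrph_simps(1) using i j by (rule G.cmp_hom)
  qed
  note iD = RGrph_homD[OF i] and jD = RGrph_homD[OF j]
  have P': "P' \<in> hom (RGrph C) (source P') (source m)"
    using kD'(2,5) by (simp add: hom_def)
  note PD = RGrph_homD(4-9)[OF P']
  have comp: "upper P = upper P' \<cdot> upper i" "lower P = lower P' \<cdot> lower i"
    "upper Q = upper Q' \<cdot> upper i" "lower Q = lower Q' \<cdot> lower i"
    using e by auto
  show "is_kernel_pair C (upper m) (upper P) (upper Q)"
    unfolding comp
    by (rule kernel_pair_transport[OF k1, of _ "Dom C (gdom (source P))" "upper j"])
      (use ij ji iD(4-9) jD(4-9) PD in \<open>simp_all add: hom_def\<close>)
  show "is_kernel_pair C (lower m) (lower P) (lower Q)"
    unfolding comp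
    by (rule kernel_pair_transport[OF k0, of _ "Cod C (gdom (source P))" "lower j"])
      (use ij ji iD(4-9) jD(4-9) PD in \<open>simp_all add: hom_def\<close>)
qed

text \<open>On generalized elements the relation \<open>K\<close> is the intersection of the inverse
  images of \<open>G\<close> along the two projections, so it inherits reflexivity, symmetry and
  transitivity. This is the step that keeps kernel pairs within iterated equivalence
  relations.\<close>

lemma equivalence_relation_kernel:
  assumes m: "m \<in> hom (RGrph C) G H"
    and P: "P \<in> hom (RGrph C) K G" and Q: "Q \<in> hom (RGrph C) K G"
    and k1: "is_kernel_pair C (upper m) (upper P) (upper Q)"
    and k0: "is_kernel_pair C (lower m) (lower P) (lower Q)"
    and G: "equivalence_relation C (gdom G) (gcod G)" and H: "jointly_monic C (gdom H) (gcod H)"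
  shows "equivalence_relation C (gdom K) (gcod K)"
proof -
  note mD = RGrph_homD[OF m] and PD = RGrph_homD[OF P] and QD = RGrph_homD[OF Q]
  note GD = reflexive_graphD[OF RGrph_ObjD(2)[OF mD(1)]]
    and HD = reflexive_graphD[OF RGrph_ObjD(2)[OF mD(2)]]
    and KD = reflexive_graphD[OF RGrph_ObjD(2)[OF PD(1)]]
  note t = mD(4-9) PD(4-9) QD(4-9) GD(1-7) HD(1-7) KD(1-7)
  note jm1 = kernel_pair_jointly_monic[OF k1] and jm0 = kernel_pair_jointly_monic[OF k0]
  have jG: "jointly_monic C (gdom G) (gcod G)"
    using G by (simp add: equivalence_relation_def)
  have jK: "jointly_monic C (gdom K) (gcod K)"
    unfolding jointly_monic_def
  proof (intro conjI ballI impI)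
    fix z a b
    assume z: "z \<in> Obj C" and a: "a \<in> hom C z (Dom C (gdom K))" and b: "b \<in> hom C z (Dom C (gdom K))"
      and e: "gdom K \<cdot> a = gdom K \<cdot> b \<and> gcod K \<cdot> a = gcod K \<cdot> b"
    note ab = homD[OF a] homD[OF b]
    have r: "upper R \<cdot> a = upper R \<cdot> b" if R: "R \<in> hom (RGrph C) K G" for R
    proof (rule jointly_monicD[OF jG z])
      note RD = RGrph_homD[OF R]
      have "gdom G \<cdot> (upper R \<cdot> a) = lower R \<cdot> (gdom K \<cdot> a)"
        by (rule square_cmp[OF RD(10)]) (use RD(4-9) t ab in simp_all)
      also have "\<dots> = lower R \<cdot> (gdom K \<cdot> b)"
        using e by simp
      also have "\<dots> = gdom G \<cdot> (upper R \<cdot> b)"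
        by (rule square_cmp[OF RD(10)[symmetric]]) (use RD(4-9) t ab in simp_all)
      finally show "gdom G \<cdot> (upper R \<cdot> a) = gdom G \<cdot> (upper R \<cdot> b)" .
      have "gcod G \<cdot> (upper R \<cdot> a) = lower R \<cdot> (gcod K \<cdot> a)"
        by (rule square_cmp[OF RD(11)]) (use RD(4-9) t ab in simp_all)
      also have "\<dots> = lower R \<cdot> (gcod K \<cdot> b)"
        using e by simp
      also have "\<dots> = gcod G \<cdot> (upper R \<cdot> b)"
        by (rule square_cmp[OF RD(11)[symmetric]]) (use RD(4-9) t ab in simp_all)
      finally show "gcod G \<cdot> (upper R \<cdot> a) = gcod G \<cdot> (upper R \<cdot> b)" .
    qed (use RGrph_homD(4-9)[OF R] ab in \<open>simp_all add: hom_def cat_simps\<close>)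
    show "a = b"
      by (rule jointly_monicD[OF jm1 z _ _ r[OF P] r[OF Q]]) (use t ab in \<open>simp_all add: hom_def\<close>)
  qed (use t in simp_all)

  have rel: "(x, y) \<in> elem_rel C (gdom K) (gcod K) z \<longleftrightarrow>
      (lower P \<cdot> x, lower P \<cdot> y) \<in> elem_rel C (gdom G) (gcod G) z \<and>
      (lower Q \<cdot> x, lower Q \<cdot> y) \<in> elem_rel C (gdom G) (gcod G) z" (is "?L \<longleftrightarrow> ?R")
    if z: "z \<in> Obj C" and x: "x \<in> hom C z (Cod C (gdom K))" and y: "y \<in> hom C z (Cod C (gdom K))"
    for x y z
  proof
    assume ?L
    then obtain h where h: "h \<in> hom C z (Dom C (gdom K))" "x = gdom K \<cdot> h" "y = gcod K \<cdot> h"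
      by (auto simp: elem_rel_def)
    have "(lower R \<cdot> x, lower R \<cdot> y) \<in> elem_rel C (gdom G) (gcod G) z" if R: "R \<in> hom (RGrph C) K G" for R
    proof -
      note RD = RGrph_homD[OF R]
      have "gdom G \<cdot> (upper R \<cdot> h) = lower R \<cdot> x"
        unfolding h by (rule square_cmp[OF RD(10)]) (use RD(4-9) t homD[OF h(1)] in simp_all)
      moreover have "gcod G \<cdot> (upper R \<cdot> h) = lower R \<cdot> y"
        unfolding h by (rule square_cmp[OF RD(11)]) (use RD(4-9) t homD[OF h(1)] in simp_all)
      moreover have "upper R \<cdot> h \<in> hom C z (Dom C (gdom G))"
        using RD(4-9) homD[OF h(1)] by (simp add: hom_def cat_simps)
      ultimately show ?thesis
        unfolding elem_rel_def by force
    qed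
    then show ?R using P Q by blast
  next
    assume ?R
    then obtain \<alpha> \<beta> where \<alpha>: "\<alpha> \<in> hom C z (Dom C (gdom G))" "gdom G \<cdot> \<alpha> = lower P \<cdot> x" "gcod G \<cdot> \<alpha> = lower P \<cdot> y"
      and \<beta>: "\<beta> \<in> hom C z (Dom C (gdom G))" "gdom G \<cdot> \<beta> = lower Q \<cdot> x" "gcod G \<cdot> \<beta> = lower Q \<cdot> y"
      by (auto simp: elem_rel_def)
    note t' = t homD[OF \<alpha>(1)] homD[OF \<beta>(1)] homD[OF x] homD[OF y]
    have e: "lower m \<cdot> (lower P \<cdot> w) = lower m \<cdot> (lower Q \<cdot> w)" if w: "w \<in> hom C z (Cod C (gdom K))" for w
      by (rule square_cmp[OF kernel_pairD(7)[OF k0]]) (use t homD[OF w] in simp_all)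
    \<comment> \<open>The edges \<alpha> and \<beta> of \<open>G\<close> have endpoints that
      \<open>lower m\<close> identifies. Since \<open>H\<close> is a relation, its edges are
      determined by their endpoints, so \<open>upper m\<close> identifies \<alpha> and \<beta> and
      the pair lifts to an edge of \<open>K\<close>.\<close>
    have "upper m \<cdot> \<alpha> = upper m \<cdot> \<beta>"
    proof (rule jointly_monicD[OF H z])
      have "gdom H \<cdot> (upper m \<cdot> \<alpha>) = lower m \<cdot> (gdom G \<cdot> \<alpha>)"
        by (rule square_cmp[OF mD(10)]) (use t' in simp_all)
      also have "\<dots> = lower m \<cdot> (gdom G \<cdot> \<beta>)"
        unfolding \<alpha> \<beta> by (rule e[OF x])
      also have "\<dots> = gdom H \<cdot> (upper m \<cdot> \<beta>)"
        by (rule square_cmp[OF mD(10)[symmetric]]) (use t' in simp_all)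
      finally show "gdom H \<cdot> (upper m \<cdot> \<alpha>) = gdom H \<cdot> (upper m \<cdot> \<beta>)" .
      have "gcod H \<cdot> (upper m \<cdot> \<alpha>) = lower m \<cdot> (gcod G \<cdot> \<alpha>)"
        by (rule square_cmp[OF mD(11)]) (use t' in simp_all)
      also have "\<dots> = lower m \<cdot> (gcod G \<cdot> \<beta>)"
        unfolding \<alpha> \<beta> by (rule e[OF y])
      also have "\<dots> = gcod H \<cdot> (upper m \<cdot> \<beta>)"
        by (rule square_cmp[OF mD(11)[symmetric]]) (use t' in simp_all)
      finally show "gcod H \<cdot> (upper m \<cdot> \<alpha>) = gcod H \<cdot> (upper m \<cdot> \<beta>)" .
    qed (use t' in \<open>simp_all add: hom_def cat_simps\<close>)
    from kernel_pair_lift[OF k1 z _ _ this] \<alpha>(1) \<beta>(1)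
    obtain h where h: "h \<in> hom C z (Dom C (upper P))" "upper P \<cdot> h = \<alpha>" "upper Q \<cdot> h = \<beta>"
      unfolding mD(5) by blast
    note h' = homD[OF h(1)]
    have sq: "lower R \<cdot> (gdom K \<cdot> h) = gdom G \<cdot> (upper R \<cdot> h)" "lower R \<cdot> (gcod K \<cdot> h) = gcod G \<cdot> (upper R \<cdot> h)"
      if R: "R \<in> hom (RGrph C) K G" for R
    proof -
      note RD = RGrph_homD[OF R]
      show "lower R \<cdot> (gdom K \<cdot> h) = gdom G \<cdot> (upper R \<cdot> h)"
        by (rule square_cmp[OF RD(10)[symmetric]]) (use RD(4-9) t h' in simp_all)
      show "lower R \<cdot> (gcod K \<cdot> h) = gcod G \<cdot> (upper R \<cdot> h)"
        by (rule square_cmp[OF RD(11)[symmetric]]) (use RD(4-9) t h' in simp_all)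
    qed
    \<comment> \<open>The lifted edge has the right endpoints because these are recognized by the
      jointly monic pair \<open>lower P\<close>, \<open>lower Q\<close>.\<close>
    have "gdom K \<cdot> h = x"
      by (rule jointly_monicD[OF jm0 z]) (use sq[OF P] sq[OF Q] h \<alpha> \<beta> t' h' in \<open>simp_all add: hom_def cat_simps\<close>)
    moreover have "gcod K \<cdot> h = y"
      by (rule jointly_monicD[OF jm0 z]) (use sq[OF P] sq[OF Q] h \<alpha> \<beta> t' h' in \<open>simp_all add: hom_def cat_simps\<close>)
    ultimately show ?L
      using h(1) unfolding PD(5) elem_rel_def by blast
  qed
  have "equiv (hom C z (Cod C (gdom K))) (elem_rel C (gdom K) (gcod K) z)" if z: "z \<in> Obj C" for z
  proof -
    have eq: "equiv (hom C z (Cod C (gdom G))) (elem_rel C (gdom G) (gcod G) z)"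
      using G z unfolding equivalence_relation_def by blast
    have low: "lower R \<cdot> x \<in> hom C z (Cod C (gdom G))"
      if "R \<in> hom (RGrph C) K G" "x \<in> hom C z (Cod C (gdom K))" for R x
      using RGrph_homD(4-9)[OF that(1)] homD[OF that(2)] by (simp add: hom_def cat_simps)
    have sub: "elem_rel C (gdom K) (gcod K) z \<subseteq> hom C z (Cod C (gdom K)) \<times> hom C z (Cod C (gdom K))"
      using KD(1-7) by (auto simp: elem_rel_def hom_def cat_simps)
    show ?thesis
    proof (rule equivI[OF sub])
      show "refl_on (hom C z (Cod C (gdom K))) (elem_rel C (gdom K) (gcod K) z)"
        using eq low P Q rel[OF z] by (auto simp: equiv_def refl_on_def)
      show "sym (elem_rel C (gdom K) (gcod K) z)"
      proof (rule symI)
        fix x y assume r: "(x, y) \<in> elem_rel C (gdom K) (gcod K) z"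
        with sub have x: "x \<in> hom C z (Cod C (gdom K))" and y: "y \<in> hom C z (Cod C (gdom K))"
          by blast+
        show "(y, x) \<in> elem_rel C (gdom K) (gcod K) z"
          using r eq unfolding rel[OF z x y] rel[OF z y x] equiv_def by (blast dest: symD)
      qed
      show "trans (elem_rel C (gdom K) (gcod K) z)"
      proof (rule transI)
        fix x y w assume r: "(x, y) \<in> elem_rel C (gdom K) (gcod K) z" "(y, w) \<in> elem_rel C (gdom K) (gcod K) z"
        with sub have x: "x \<in> hom C z (Cod C (gdom K))" and y: "y \<in> hom C z (Cod C (gdom K))"
          and w: "w \<in> hom C z (Cod C (gdom K))"
          by blast+
        show "(x, w) \<in> elem_rel C (gdom K) (gcod K) z"
          using r eq unfolding rel[OF z x y] rel[OF z y w] rel[OF z x w] equiv_def by (blast dest: transD)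
      qed
    qed
  qed
  then show ?thesis
    using jK KD(5) by (simp add: equivalence_relation_def)
qed

end

subsection \<open>The functor Eq\<close>

context cells
begin

text \<open>Into a relation, compatibility with the units is automatic: both sides become
  \<open>l\<close> after either projection of \<open>H\<close>.\<close>

lemma RGrph_hom_to_jointly_monic:
  assumes "G \<in> Obj (RGrph C)" "H \<in> Obj (RGrph C)" "jointly_monic C (gdom H) (gcod H)"
    "u \<in> hom C (Dom C (gdom G)) (Dom C (gdom H))" "l \<in> hom C (Cod C (gdom G)) (Cod C (gdom H))"
    "gdom H \<cdot> u = l \<cdot> gdom G" "gcod H \<cdot> u = l \<cdot> gcod G"
  shows "Map G H u l \<in> hom (RGrph C) G H"
proof (rule RGrph_homI[OF assms(1,2,4-7)])
  note GD = reflexive_graphD[OF RGrph_ObjD(2)[OF assms(1)]]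
    and HD = reflexive_graphD[OF RGrph_ObjD(2)[OF assms(2)]]
  note t = GD(1-7) HD(1-7) homD[OF assms(4)] homD[OF assms(5)]
  show "gunit H \<cdot> l = u \<cdot> gunit G"
  proof (rule jointly_monicD[OF assms(3), of "Cod C (gdom G)"])
    have "gdom H \<cdot> (gunit H \<cdot> l) = (gdom H \<cdot> gunit H) \<cdot> l"
      by (rule cmp_assoc[symmetric]) (use t in simp_all)
    also have "\<dots> = l \<cdot> (gdom G \<cdot> gunit G)"
      unfolding GD(8) HD(8) using t by (simp add: cat_simps)
    also have "\<dots> = gdom H \<cdot> (u \<cdot> gunit G)"
      by (rule square_cmp[OF assms(6)[symmetric]]) (use t in simp_all)
    finally show "gdom H \<cdot> (gunit H \<cdot> l) = gdom H \<cdot> (u \<cdot> gunit G)" .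
    have "gcod H \<cdot> (gunit H \<cdot> l) = (gcod H \<cdot> gunit H) \<cdot> l"
      by (rule cmp_assoc[symmetric]) (use t in simp_all)
    also have "\<dots> = l \<cdot> (gcod G \<cdot> gunit G)"
      unfolding GD(9) HD(9) using t by (simp add: cat_simps)
    also have "\<dots> = gcod H \<cdot> (u \<cdot> gunit G)"
      by (rule square_cmp[OF assms(7)[symmetric]]) (use t in simp_all)
    finally show "gcod H \<cdot> (gunit H \<cdot> l) = gcod H \<cdot> (u \<cdot> gunit G)" .
  qed (use t in \<open>simp_all add: hom_def cat_simps\<close>)
qed

text \<open>An edge of a relation is determined by its endpoints. This makes the description in
  \<open>Eq\<close> unique, and its iteration makes the underlying object faithful.\<close>

lemma RGrph_hom_eqI:
  assumes "jointly_monic C (gdom H) (gcod H)" "h \<in> hom (RGrph C) G H" "k \<in> hom (RGrph C) G H"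
    and "lower h = lower k"
  shows "h = k"
proof (rule RGrph_eqI[OF assms(2,3) _ assms(4)])
  note hD = RGrph_homD[OF assms(2)] and kD = RGrph_homD[OF assms(3)]
  show "upper h = upper k"
    by (rule jointly_monicD[OF assms(1), of "Dom C (gdom G)"])
      (use hD(4-6,10,11) kD(4-6,10,11) assms(4) dom_obj[OF hD(4)] in \<open>simp_all add: hom_def\<close>)
qed

text \<open>Condition \<open>e\<close> says that \<open>l\<close> maps edges of \<open>G\<close> to
  pairs identified by \<open>f\<close>; the universal property then yields the edge component. Every
  morphism into a kernel graph is produced in this way.\<close>

lemma RGrph_hom_to_kernel_pair:
  assumes k: "is_kernel_pair C f (gdom H) (gcod H)" and "G \<in> Obj (RGrph C)" "H \<in> Obj (RGrph C)"
    and "l \<in> hom C (Cod C (gdom G)) (Dom C f)" and e: "f \<cdot> (l \<cdot> gdom G) = f \<cdot> (l \<cdot> gcod G)"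
  obtains h where "h \<in> hom (RGrph C) G H" "lower h = l"
proof -
  note kD = kernel_pairD[OF k]
  note GD = reflexive_graphD[OF RGrph_ObjD(2)[OF assms(2)]] and lD = homD[OF assms(4)]
  obtain u where u: "u \<in> hom C (Dom C (gdom G)) (Dom C (gdom H))"
    "gdom H \<cdot> u = l \<cdot> gdom G" "gcod H \<cdot> u = l \<cdot> gcod G"
    by (rule kernel_pair_lift[OF k _ _ _ e, of "Dom C (gdom G)"])
      (use GD(1-7) lD in \<open>simp_all add: hom_def cat_simps\<close>)
  have "Map G H u l \<in> hom (RGrph C) G H"
    by (rule RGrph_hom_to_jointly_monic[OF assms(2,3) kernel_pair_jointly_monic[OF k] u(1) _ u(2,3)])
      (use kD(5) assms(4) in simp)
  then show ?thesis by (rule that) simp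
qed

end

locale kernel_cells = cells +
  assumes kernel_pairs: "has_kernel_pairs C"
begin

lemma kernel_graph:
  assumes "f \<in> Mor C"
  shows "kernel_graph C f \<in> Obj (RGrph C)"
    and "is_kernel_pair C f (gdom (kernel_graph C f)) (gcod (kernel_graph C f))"
proof -
  obtain p q where k: "is_kernel_pair C f p q"
    using kernel_pairs assms by (auto simp: has_kernel_pairs_def)
  note kD = kernel_pairD[OF k]
  \<comment> \<open>The unit is the diagonal, the lift of the pair of identities.\<close>
  obtain s where s: "s \<in> hom C (Dom C f) (Dom C p)" "p \<cdot> s = Ide C (Dom C f)" "q \<cdot> s = Ide C (Dom C f)"
    by (rule kernel_pair_lift[OF k, of "Dom C f" "Ide C (Dom C f)" "Ide C (Dom C f)"])
      (use assms in \<open>simp_all add: dom_obj ide_hom\<close>)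
  have "Graph p q s \<in> Obj (RGrph C)"
    unfolding RGrph_Obj_iff by (rule reflexive_graphI) (use kD(1-6) s homD[OF s(1)] in simp_all)
  then have "\<exists>G. G \<in> Obj (RGrph C) \<and> is_kernel_pair C f (gdom G) (gcod G)"
    using k by (intro exI[of _ "Graph p q s"]) simp
  from someI_ex[OF this] show "kernel_graph C f \<in> Obj (RGrph C)"
    and "is_kernel_pair C f (gdom (kernel_graph C f)) (gcod (kernel_graph C f))"
    unfolding kernel_graph_def by blast+
qed

text \<open>The commuting square \<open>h\<close> forces \<open>upper h\<close> to carry pairs
  identified by \<open>f\<close> to pairs identified by \<open>g\<close>, so a morphism of kernel
  graphs exists; it is unique because kernel pairs are jointly monic, and the definite description
  in \<open>Eq\<close> has a value.\<close>

lemma Eq_mor: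
  assumes h: "h \<in> hom (Arr C) f g"
  shows "on_mor (Eq C) h \<in> hom (RGrph C) (kernel_graph C f) (kernel_graph C g)"
    and "lower (on_mor (Eq C) h) = upper h"
proof -
  note hD = Arr_homD[OF h]
  note k = kernel_graph[OF hD(1)] and k' = kernel_graph[OF hD(2)]
  note jm = kernel_pair_jointly_monic[OF k'(2)]
  note kD = kernel_pairD[OF k(2)]
  have "g \<cdot> (upper h \<cdot> gdom (kernel_graph C f)) = lower h \<cdot> (f \<cdot> gdom (kernel_graph C f))"
    by (rule square_cmp[OF hD(10)[symmetric]]) (use hD(1,2,4-9) kD(1-6) in simp_all)
  also have "\<dots> = lower h \<cdot> (f \<cdot> gcod (kernel_graph C f))"
    using kD(7) by simp
  also have "\<dots> = g \<cdot> (upper h \<cdot> gcod (kernel_graph C f))"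
    by (rule square_cmp[OF hD(10)]) (use hD(1,2,4-9) kD(1-6) in simp_all)
  finally obtain m where m: "m \<in> hom (RGrph C) (kernel_graph C f) (kernel_graph C g)" "lower m = upper h"
    by (rule RGrph_hom_to_kernel_pair[OF k'(2) k(1) k'(1), rotated]) (use hD(4-6) kD(5) in \<open>simp_all add: hom_def\<close>)
  have "\<exists>!m. m \<in> hom (RGrph C) (kernel_graph C f) (kernel_graph C g) \<and> lower m = upper h"
    using m RGrph_hom_eqI[OF jm] by metis
  from theI'[OF this] h
  show "on_mor (Eq C) h \<in> hom (RGrph C) (kernel_graph C f) (kernel_graph C g)"
    and "lower (on_mor (Eq C) h) = upper h"
    by (simp_all add: Eq_def hom_def)
qed

lemma Eq_cmp:
  assumes h: "h \<in> hom (Arr C) f g" and k: "k \<in> hom (Arr C) g j"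
  shows "on_mor (Eq C) (k \<cdot>\<^bsub>Arr C\<^esub> h) = on_mor (Eq C) k \<cdot>\<^bsub>RGrph C\<^esub> on_mor (Eq C) h"
proof (rule RGrph_hom_eqI)
  interpret A: category "Arr C" by (rule category_Arr)
  interpret G: category "RGrph C" by (rule category_RGrph)
  show "jointly_monic C (gdom (kernel_graph C j)) (gcod (kernel_graph C j))"
    by (rule kernel_pair_jointly_monic[OF kernel_graph(2)[OF Arr_homD(2)[OF k]]])
  note kh = A.cmp_hom[OF h k]
  show "on_mor (Eq C) (k \<cdot>\<^bsub>Arr C\<^esub> h) \<in> hom (RGrph C) (kernel_graph C f) (kernel_graph C j)"
    by (rule Eq_mor(1)[OF kh])
  show "on_mor (Eq C) k \<cdot>\<^bsub>RGrph C\<^esub> on_mor (Eq C) h \<in> hom (RGrph C) (kernel_graph C f) (kernel_graph C j)"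
    by (rule G.cmp_hom[OF Eq_mor(1)[OF h] Eq_mor(1)[OF k]])
  show "lower (on_mor (Eq C) (k \<cdot>\<^bsub>Arr C\<^esub> h)) = lower (on_mor (Eq C) k \<cdot>\<^bsub>RGrph C\<^esub> on_mor (Eq C) h)"
    using Eq_mor(2)[OF kh] Eq_mor(2)[OF h] Eq_mor(2)[OF k] by simp
qed

end

subsection \<open>The base category as a category of cells\<close>

lemma embed_simps [simp]:
  "Obj (embed C) = Ob ` Obj C" "Mor (embed C) = Mo ` Mor C"
  "Dom (embed C) f = Ob (Dom C (base_mor f))" "Cod (embed C) f = Ob (Cod C (base_mor f))"
  "Ide (embed C) a = Mo (Ide C (base_obj a))"
  "g \<cdot>\<^bsub>embed C\<^esub> f = Mo (base_mor g \<cdot>\<^bsub>C\<^esub> base_mor f)"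
  by (simp_all add: embed_def)

lemma hom_embed: "hom (embed C) (Ob a) (Ob b) = Mo ` hom C a b"
  by (auto simp: hom_def)

lemma embed_homE:
  assumes "f \<in> hom (embed C) a b"
  obtains f' a' b' where "f = Mo f'" "a = Ob a'" "b = Ob b'" "f' \<in> hom C a' b'"
  using assms by (auto simp: hom_def)

context category
begin

lemma category_embed: "category (embed C)"
proof
  fix f g a b c
  assume f: "f \<in> hom (embed C) a b" and g: "g \<in> hom (embed C) b c"
  from f obtain f' a' b' where [simp]: "f = Mo f'" "a = Ob a'" "b = Ob b'" and f': "f' \<in> hom C a' b'"
    by (rule embed_homE)
  from g obtain g' c' where [simp]: "g = Mo g'" "c = Ob c'" and g': "g' \<in> hom C b' c'"
    by (auto elim!: embed_homE)
  show "g \<cdot>\<^bsub>embed C\<^esub> f \<in> hom (embed C) a c"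
    using cmp_hom[OF f' g'] by (simp add: hom_embed)
  fix h d
  assume "h \<in> hom (embed C) c d"
  then obtain h' d' where [simp]: "h = Mo h'" "d = Ob d'" and h': "h' \<in> hom C c' d'"
    by (auto elim!: embed_homE)
  show "h \<cdot>\<^bsub>embed C\<^esub> (g \<cdot>\<^bsub>embed C\<^esub> f) = h \<cdot>\<^bsub>embed C\<^esub> g \<cdot>\<^bsub>embed C\<^esub> f"
    using assoc[OF f' g' h'] by simp
next
  fix f a b
  assume "f \<in> hom (embed C) a b"
  then show "f \<cdot>\<^bsub>embed C\<^esub> Ide (embed C) a = f" "Ide (embed C) b \<cdot>\<^bsub>embed C\<^esub> f = f"
    by (auto elim!: embed_homE simp: ide_left ide_right)
qed (auto simp: dom_obj cod_obj ide_hom hom_embed)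

end

lemma kernel_pair_embed:
  assumes "is_kernel_pair C f p q"
  shows "is_kernel_pair (embed C) (Mo f) (Mo p) (Mo q)"
  unfolding is_pullback_def
proof (intro conjI ballI impI)
  fix z u v
  assume z: "z \<in> Obj (embed C)" and u: "u \<in> hom (embed C) z (Dom (embed C) (Mo f))"
    and v: "v \<in> hom (embed C) z (Dom (embed C) (Mo f))"
    and e: "Mo f \<cdot>\<^bsub>embed C\<^esub> u = Mo f \<cdot>\<^bsub>embed C\<^esub> v"
  obtain z' where [simp]: "z = Ob z'" and z': "z' \<in> Obj C"
    using z by auto
  obtain u' v' where [simp]: "u = Mo u'" "v = Mo v'" and u': "u' \<in> hom C z' (Dom C f)" "v' \<in> hom C z' (Dom C f)"
    using u v by (auto simp: hom_embed)
  have "f \<cdot>\<^bsub>C\<^esub> u' = f \<cdot>\<^bsub>C\<^esub> v'"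
    using e by simp
  note ex = kernel_pair_ex1[OF assms z' u' this]
  then obtain h where h: "h \<in> hom C z' (Dom C p) \<and> p \<cdot>\<^bsub>C\<^esub> h = u' \<and> q \<cdot>\<^bsub>C\<^esub> h = v'"
    by (rule ex1E) blast
  have uniq: "k = h" if "k \<in> hom C z' (Dom C p) \<and> p \<cdot>\<^bsub>C\<^esub> k = u' \<and> q \<cdot>\<^bsub>C\<^esub> k = v'" for k
    using ex h that by blast
  show "\<exists>!h. h \<in> hom (embed C) z (Dom (embed C) (Mo p)) \<and> Mo p \<cdot>\<^bsub>embed C\<^esub> h = u \<and> Mo q \<cdot>\<^bsub>embed C\<^esub> h = v"
    by (rule ex1I[of _ "Mo h"]) (use h in \<open>auto simp: hom_embed intro!: uniq\<close>)
qed (use kernel_pairD[OF assms] in simp_all)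

lemma has_kernel_pairs_embed:
  assumes "has_kernel_pairs C"
  shows "has_kernel_pairs (embed C)"
proof -
  have "\<exists>p q. is_kernel_pair (embed C) (Mo f) p q" if "f \<in> Mor C" for f
    using assms that kernel_pair_embed[of C f] unfolding has_kernel_pairs_def by blast
  then show ?thesis
    by (auto simp: has_kernel_pairs_def)
qed

lemma terminal_embed:
  assumes "is_terminal C t"
  shows "is_terminal (embed C) (Ob t)"
proof -
  have "\<exists>!f. f \<in> hom (embed C) (Ob a) (Ob t)" if "a \<in> Obj C" for a
  proof -
    obtain f where f: "f \<in> hom C a t" "\<And>g. g \<in> hom C a t \<Longrightarrow> g = f"
      using assms \<open>a \<in> Obj C\<close> unfolding is_terminal_def by metis
    show ?thesis
      by (rule ex1I[of _ "Mo f"]) (use f(1) in \<open>auto simp: hom_embed intro!: f(2)\<close>)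
  qed
  then show ?thesis
    using assms by (auto simp: is_terminal_def)
qed

text \<open>Exactness speaks about the base category, whereas the entries of a tuple are relations
  in its embedded copy. Injectivity of \<open>Mo\<close> lets the equivalence on generalized
  elements be read back.\<close>

lemma equivalence_relation_embedD:
  fixes C :: "('o, 'm) category"
  assumes "equivalence_relation (embed C) d c"
  obtains d' c' where "d = Mo d'" "c = Mo c'" "equivalence_relation C d' c'"
proof -
  obtain d' c' where [simp]: "d = Mo d'" "c = Mo c'" and dc: "d' \<in> Mor C" "c' \<in> Mor C"
    using assms by (auto simp: equivalence_relation_def jointly_monic_def)
  have jm: "jointly_monic (embed C) d c" and cod: "Cod C d' = Cod C c'"
    using assms by (auto simp: equivalence_relation_def)
  have "jointly_monic C d' c'"
    unfolding jointly_monic_def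
  proof (intro conjI ballI impI)
    fix z u v assume z: "z \<in> Obj C" "u \<in> hom C z (Dom C d')" "v \<in> hom C z (Dom C d')"
      and e: "d' \<cdot>\<^bsub>C\<^esub> u = d' \<cdot>\<^bsub>C\<^esub> v \<and> c' \<cdot>\<^bsub>C\<^esub> u = c' \<cdot>\<^bsub>C\<^esub> v"
    have "(Mo u :: ('o, 'm) cell) = Mo v"
      by (rule jointly_monicD[OF jm, of "Ob z"]) (use z e in \<open>simp_all add: hom_embed\<close>)
    then show "u = v" by simp
  qed (use dc jm in \<open>simp_all add: jointly_monic_def\<close>)
  moreover have "equiv (hom C z (Cod C d')) (elem_rel C d' c' z)" if z: "z \<in> Obj C" for z
  proof -
    have eq: "equiv (Mo ` hom C z (Cod C d')) (elem_rel (embed C) d c (Ob z))"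
      using assms z by (force simp: equivalence_relation_def hom_embed)
    have rel: "(x, y) \<in> elem_rel C d' c' z \<longleftrightarrow> (Mo x, Mo y) \<in> elem_rel (embed C) d c (Ob z)" for x y
      unfolding elem_rel_def by (force simp: hom_embed)
    note eqD = eq[unfolded equiv_def]
    show ?thesis
    proof (rule equivI)
      show "elem_rel C d' c' z \<subseteq> hom C z (Cod C d') \<times> hom C z (Cod C d')"
      proof (rule subrelI)
        fix x y assume "(x, y) \<in> elem_rel C d' c' z"
        then have "(Mo x, Mo y) \<in> Mo ` hom C z (Cod C d') \<times> Mo ` hom C z (Cod C d')"
          unfolding rel using eqD by blast
        then show "(x, y) \<in> hom C z (Cod C d') \<times> hom C z (Cod C d')"
          by auto
      qed
      show "refl_on (hom C z (Cod C d')) (elem_rel C d' c' z)"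
        by (rule refl_onI) (use eqD in \<open>auto simp: rel dest: refl_onD\<close>)
      show "sym (elem_rel C d' c' z)"
        by (rule symI) (use eqD in \<open>auto simp: rel dest: symD\<close>)
      show "trans (elem_rel C d' c' z)"
        by (rule transI) (use eqD in \<open>auto simp: rel dest: transD\<close>)
    qed
  qed
  ultimately have "equivalence_relation C d' c'"
    using cod by (simp add: equivalence_relation_def)
  then show ?thesis by (rule that[rotated 2]) simp_all
qed

subsection \<open>Iterated reflexive graphs and equivalence relations\<close>

lemma underlying_object_simps [simp]:
  "on_obj (underlying_object 0 X) G = G" "on_mor (underlying_object 0 X) h = h"
  "on_obj (underlying_object (Suc n) X) G = on_obj (underlying_object n X) (Cod (RGrph_n n X) (gdom G))"
  "on_mor (underlying_object (Suc n) X) h = on_mor (underlying_object n X) (lower h)"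
  by (simp_all add: id_functor_def comp_functor_def vertices_def)

declare underlying_object.simps [simp del]

lemma direction_Suc_less:
  assumes "i < n"
  shows "on_obj (direction (Suc n) X i) G = on_obj (direction n X i) (Cod (RGrph_n n X) (gdom G))"
    and "on_mor (direction (Suc n) X i) h = on_mor (direction n X i) (lower h)"
  using assms by (simp_all add: comp_functor_def vertices_def)

lemma direction_Suc_same:
  "on_obj (direction (Suc n) X n) G =
    Graph (on_mor (underlying_object n X) (gdom G)) (on_mor (underlying_object n X) (gcod G))
      (on_mor (underlying_object n X) (gunit G))"
  "on_mor (direction (Suc n) X n) h =
    Map (on_obj (direction (Suc n) X n) (source h)) (on_obj (direction (Suc n) X n) (target h))
      (on_mor (underlying_object n X) (upper h)) (on_mor (underlying_object n X) (lower h))"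
  by (simp_all add: RGrph_functor_def)

declare direction.simps [simp del]

text \<open>Free of typing conditions, since the lower part of a composite of graph morphisms is by
  definition the composite of the lower parts. It can therefore be used as a plain rewrite
  rule.\<close>

lemma underlying_object_cmp:
  "on_mor (underlying_object n X) (g \<cdot>\<^bsub>RGrph_n n X\<^esub> f) =
    on_mor (underlying_object n X) g \<cdot>\<^bsub>embed X\<^esub> on_mor (underlying_object n X) f"
  by (induction n arbitrary: f g) auto

lemma underlying_object_ide:
  "on_mor (underlying_object n X) (Ide (RGrph_n n X) G) = Ide (embed X) (on_obj (underlying_object n X) G)"
  by (induction n arbitrary: G) auto

section \<open>The full subcategory of n-fold equivalence relations\<close>

locale kernel_base = category X for X :: "('o, 'm) category" (structure) +
  assumes base_kernel_pairs: "has_kernel_pairs X"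
begin

text \<open>Having kernel pairs is the property that passes from a category to its reflexive graphs,
  and so the invariant of the iteration.\<close>

lemma RGrph_n_kernel_cells: "kernel_cells (RGrph_n n X)"
proof (induction n)
  case 0
  show ?case
    using category_embed has_kernel_pairs_embed[OF base_kernel_pairs]
    by (simp add: kernel_cells_def cells_def kernel_cells_axioms_def)
next
  case (Suc n)
  interpret R: kernel_cells "RGrph_n n X" by fact
  show ?case
    using R.category_RGrph R.has_kernel_pairs_RGrph[OF R.kernel_pairs]
    by (simp add: kernel_cells_def cells_def kernel_cells_axioms_def)
qed

lemma category_RGrph_n: "category (RGrph_n n X)"
  using RGrph_n_kernel_cells[of n] by (simp add: kernel_cells_def cells_def)

text \<open>Each application of \<open>ERel\<close> changes the base category, yet the morphisms
  remain those of \<open>n\<close>-fold reflexive graphs.\<close>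

lemma ERel_n_full: "ERel_n n X = full_subcategory (RGrph_n n X) (Obj (ERel_n n X))"
proof (cases n)
  case 0
  have "full_subcategory (embed X) UNIV = embed X"
    by (simp add: full_subcategory_def)
  then show ?thesis
    using 0 full_subcategory_Obj[OF category_embed, of UNIV] by simp
next
  case (Suc m)
  \<comment> \<open>The induction leaves the defining set unspecified, because
    \<open>ERel_full_subcategory\<close> produces a new one at each level; it is exchanged for the
    set of objects only at the end.\<close>
  have "\<exists>S. ERel_n n X = full_subcategory (RGrph_n n X) S" for n
  proof (induction n)
    case 0
    show ?case by (rule exI[of _ UNIV]) (simp add: full_subcategory_def)
  next
    case (Suc n)
    then obtain S where "ERel_n n X = full_subcategory (RGrph_n n X) S" ..
    then show ?case
      using ERel_full_subcategory[of "RGrph_n n X" S] by auto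
  qed
  then obtain S where S: "ERel_n n X = full_subcategory (RGrph_n n X) S"
    by blast
  show ?thesis
    unfolding S by (simp only: full_subcategory_simps full_subcategory_Obj[OF category_RGrph_n])
qed

lemma ERel_n_Suc_iff:
  "G \<in> Obj (ERel_n (Suc n) X) \<longleftrightarrow> G \<in> Obj (RGrph_n (Suc n) X) \<and>
    Dom (RGrph_n n X) (gdom G) \<in> Obj (ERel_n n X) \<and> Cod (RGrph_n n X) (gdom G) \<in> Obj (ERel_n n X) \<and>
    equivalence_relation (ERel_n n X) (gdom G) (gcod G)"
  using arg_cong[OF ERel_full_subcategory[of "RGrph_n n X" "Obj (ERel_n n X)",
      unfolded ERel_n_full[of n, symmetric]], of Obj]
  by auto

lemma ERel_n_subset: "G \<in> Obj (ERel_n n X) \<Longrightarrow> G \<in> Obj (RGrph_n n X)"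
  using arg_cong[OF ERel_n_full[of n], of Obj] by auto

lemma hom_ERel_n:
  assumes "G \<in> Obj (ERel_n n X)" "H \<in> Obj (ERel_n n X)"
  shows "hom (ERel_n n X) G H = hom (RGrph_n n X) G H"
  using arg_cong[OF ERel_n_full[of n], of "\<lambda>C. hom C G H"] assms
  by (simp only: hom_full_subcategory if_True simp_thms)

lemma isomorphic_ERel_n:
  assumes "G \<in> Obj (ERel_n n X)" "H \<in> Obj (ERel_n n X)"
  shows "isomorphic (ERel_n n X) G H \<longleftrightarrow> isomorphic (RGrph_n n X) G H"
  using arg_cong[OF ERel_n_full[of n], of "\<lambda>C. isomorphic C G H"] assms
  by (simp only: isomorphic_full_subcategory)

lemma cells_ERel_n: "cells (ERel_n n X)"
  using category_full_subcategory[OF category_RGrph_n[of n], of "Obj (ERel_n n X)"]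
  by (simp add: cells_def flip: ERel_n_full)

lemma Cmp_ERel_n: "Cmp (ERel_n n X) = Cmp (RGrph_n n X)"
  using arg_cong[OF ERel_n_full[of n], of Cmp] by simp

lemma Dom_ERel_n: "Dom (ERel_n n X) = Dom (RGrph_n n X)"
  using arg_cong[OF ERel_n_full[of n], of Dom] by simp

lemma kernel_pair_ERel_n:
  assumes "is_kernel_pair (RGrph_n n X) m P Q" "Dom (RGrph_n n X) m \<in> Obj (ERel_n n X)"
    "Cod (RGrph_n n X) m \<in> Obj (ERel_n n X)" "Dom (RGrph_n n X) P \<in> Obj (ERel_n n X)"
  shows "is_kernel_pair (ERel_n n X) m P Q"
  using kernel_pair_full_subcategory[OF assms] by (simp flip: ERel_n_full)

lemma RGrph_ERel_n_hom:
  assumes "h \<in> hom (RGrph (RGrph_n n X)) G H"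
    and "Dom (RGrph_n n X) (gdom G) \<in> Obj (ERel_n n X)" "Cod (RGrph_n n X) (gdom G) \<in> Obj (ERel_n n X)"
    and "Dom (RGrph_n n X) (gdom H) \<in> Obj (ERel_n n X)" "Cod (RGrph_n n X) (gdom H) \<in> Obj (ERel_n n X)"
  shows "h \<in> hom (RGrph (ERel_n n X)) G H"
proof -
  have "h \<in> hom (RGrph (full_subcategory (RGrph_n n X) (Obj (ERel_n n X)))) G H"
    unfolding RGrph_full_subcategory hom_full_subcategory using assms by simp
  then show ?thesis by (simp flip: ERel_n_full)
qed

text \<open>Induction along both components: edge and vertex objects of the kernel are kernel
  objects of \<open>upper m\<close> and \<open>lower m\<close> one level down, and
  \<open>equivalence_relation_kernel\<close>, applied inside \<open>ERel_n n\<close>, makes them an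
  equivalence relation.\<close>

lemma kernel_object_in_ERel_n:
  assumes "is_kernel_pair (RGrph_n n X) m P Q" "Dom (RGrph_n n X) m \<in> Obj (ERel_n n X)"
    "Cod (RGrph_n n X) m \<in> Obj (ERel_n n X)"
  shows "Dom (RGrph_n n X) P \<in> Obj (ERel_n n X)"
  using assms
proof (induction n arbitrary: m P Q)
  case 0
  then show ?case
    using category.dom_obj[OF category_embed] kernel_pairD(2)[of "embed X" m P Q] by simp
next
  case (Suc n)
  interpret R: kernel_cells "RGrph_n n X" by (rule RGrph_n_kernel_cells)
  interpret E: cells "ERel_n n X" by (rule cells_ERel_n)
  define K G H where "K = source P" and "G = source m" and "H = target m"
  have k: "is_kernel_pair (RGrph (RGrph_n n X)) m P Q"
    using Suc.prems(1) by simp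
  note kD = kernel_pairD[OF k, unfolded RGrph_simps]
  note k10 = R.RGrph_kernel_pair_components[OF R.kernel_pairs k]
  have m: "m \<in> hom (RGrph (RGrph_n n X)) G H" and P: "P \<in> hom (RGrph (RGrph_n n X)) K G"
    and Q: "Q \<in> hom (RGrph (RGrph_n n X)) K G"
    using kD by (simp_all add: hom_def K_def G_def H_def)
  have G: "G \<in> Obj (ERel_n (Suc n) X)" and H: "H \<in> Obj (ERel_n (Suc n) X)"
    using Suc.prems(2,3) by (simp_all add: G_def H_def)
  note GE = G[unfolded ERel_n_Suc_iff] and HE = H[unfolded ERel_n_Suc_iff]
  note mD = RGrph_homD[OF m] and PD = RGrph_homD[OF P]
  have K1: "Dom (RGrph_n n X) (gdom K) \<in> Obj (ERel_n n X)"
    using Suc.IH[OF k10(1)] GE HE by (simp only: mD(5,6) PD(5))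
  have K0: "Cod (RGrph_n n X) (gdom K) \<in> Obj (ERel_n n X)"
    using Suc.IH[OF k10(2)] GE HE by (simp only: mD(8,9) PD(8))
  have k1: "is_kernel_pair (ERel_n n X) (upper m) (upper P) (upper Q)"
    by (rule kernel_pair_ERel_n[OF k10(1)]) (use GE HE K1 in \<open>simp_all only: mD(5,6) PD(5)\<close>)
  have k0: "is_kernel_pair (ERel_n n X) (lower m) (lower P) (lower Q)"
    by (rule kernel_pair_ERel_n[OF k10(2)]) (use GE HE K0 in \<open>simp_all only: mD(8,9) PD(8)\<close>)
  have "equivalence_relation (ERel_n n X) (gdom K) (gcod K)"
  proof (rule E.equivalence_relation_kernel[OF _ _ _ k1 k0])
    show "m \<in> hom (RGrph (ERel_n n X)) G H"
      by (rule RGrph_ERel_n_hom[OF m]) (use GE HE in simp_all)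
    show "P \<in> hom (RGrph (ERel_n n X)) K G"
      by (rule RGrph_ERel_n_hom[OF P]) (use GE K1 K0 in simp_all)
    show "Q \<in> hom (RGrph (ERel_n n X)) K G"
      by (rule RGrph_ERel_n_hom[OF Q]) (use GE K1 K0 in simp_all)
    show "equivalence_relation (ERel_n n X) (gdom G) (gcod G)"
      using GE by simp
    show "jointly_monic (ERel_n n X) (gdom H) (gcod H)"
      using HE by (simp add: equivalence_relation_def)
  qed
  then have "K \<in> Obj (ERel_n (Suc n) X)"
    unfolding ERel_n_Suc_iff using K1 K0 PD(1) by simp
  then show ?case
    by (simp add: K_def)
qed

section \<open>Underlying objects and directions of n-fold graphs\<close>

lemma underlying_object_hom:
  assumes "h \<in> hom (RGrph_n n X) G H"
  shows "on_mor (underlying_object n X) h \<in>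
    hom (embed X) (on_obj (underlying_object n X) G) (on_obj (underlying_object n X) H)"
  using assms
proof (induction n arbitrary: h G H)
  case (Suc n)
  have "h \<in> hom (RGrph (RGrph_n n X)) G H"
    using Suc.prems by simp
  note hD = RGrph_homD[OF this]
  show ?case
    using Suc.IH[OF homI[OF hD(7-9)]] by simp
qed simp

text \<open>Equality climbs from the lower to the upper component through the jointly monic pair of
  \<open>H\<close>. That pair is jointly monic in \<open>ERel_n n\<close>, so the edge object of
  \<open>G\<close>, on which it is tested, has to lie there too.\<close>

lemma underlying_object_faithful:
  assumes "G \<in> Obj (ERel_n n X)" "H \<in> Obj (ERel_n n X)"
    and "h \<in> hom (RGrph_n n X) G H" "k \<in> hom (RGrph_n n X) G H"
    and "on_mor (underlying_object n X) h = on_mor (underlying_object n X) k"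
  shows "h = k"
  using assms
proof (induction n arbitrary: h k G H)
  case (Suc n)
  note GE = Suc.prems(1)[unfolded ERel_n_Suc_iff] and HE = Suc.prems(2)[unfolded ERel_n_Suc_iff]
  have h: "h \<in> hom (RGrph (RGrph_n n X)) G H" and k: "k \<in> hom (RGrph (RGrph_n n X)) G H"
    using Suc.prems by simp_all
  note hD = RGrph_homD[OF h] and kD = RGrph_homD[OF k]
  have low: "lower h = lower k"
    by (rule Suc.IH[OF _ _ homI[OF hD(7-9)] homI[OF kD(7-9)]])
      (use GE HE Suc.prems(5) in simp_all)
  have jm: "jointly_monic (ERel_n n X) (gdom H) (gcod H)"
    using HE by (simp add: equivalence_relation_def)
  have "upper h = upper k"
  proof (rule jointly_monicD[OF jm], unfold Dom_ERel_n Cmp_ERel_n)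
    show "Dom (RGrph_n n X) (gdom G) \<in> Obj (ERel_n n X)"
      using GE by simp
    show "upper h \<in> hom (ERel_n n X) (Dom (RGrph_n n X) (gdom G)) (Dom (RGrph_n n X) (gdom H))"
      "upper k \<in> hom (ERel_n n X) (Dom (RGrph_n n X) (gdom G)) (Dom (RGrph_n n X) (gdom H))"
      using homI[OF hD(4-6)] homI[OF kD(4-6)] GE HE by (simp_all add: hom_ERel_n)
  qed (simp_all only: hD(10,11) kD(10,11) low)
  then show ?case
    using RGrph_eqI[OF h k _ low] by simp
qed simp

lemma underlying_object_kernel_pair:
  assumes "is_kernel_pair (RGrph_n n X) m P Q"
  shows "is_kernel_pair (embed X) (on_mor (underlying_object n X) m)
    (on_mor (underlying_object n X) P) (on_mor (underlying_object n X) Q)"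
  using assms
proof (induction n arbitrary: m P Q)
  case (Suc n)
  interpret R: kernel_cells "RGrph_n n X" by (rule RGrph_n_kernel_cells)
  show ?case
    using Suc.IH[OF R.RGrph_kernel_pair_components(2)[OF R.kernel_pairs]] Suc.prems by simp
qed simp

text \<open>The outermost direction is the image of \<open>G\<close> under
  \<open>underlying_object\<close>, which preserves the equations of a graph; the other directions
  are those of the object of vertices.\<close>

lemma direction_Obj:
  assumes "G \<in> Obj (RGrph_n n X)" "i < n"
  shows "on_obj (direction n X i) G \<in> Obj (RGrph (embed X))"
    and "Cod (embed X) (gdom (on_obj (direction n X i) G)) = on_obj (underlying_object n X) G"
proof -
  have "on_obj (direction n X i) G \<in> Obj (RGrph (embed X)) \<and>
      Cod (embed X) (gdom (on_obj (direction n X i) G)) = on_obj (underlying_object n X) G"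
    using assms
  proof (induction n arbitrary: G)
    case (Suc n)
    have G: "G \<in> Obj (RGrph (RGrph_n n X))"
      using Suc.prems by simp
    note GD = reflexive_graphD[OF RGrph_ObjD(2)[OF G]]
    let ?u = "on_mor (underlying_object n X)"
    note d = homD[OF underlying_object_hom[OF homI[OF GD(1) refl refl]]]
      and c = homD[OF underlying_object_hom[OF homI[OF GD(2,4,5)]]]
      and s = homD[OF underlying_object_hom[OF homI[OF GD(3,6,7)]]]
    have V: "Cod (RGrph_n n X) (gdom G) \<in> Obj (RGrph_n n X)"
      using GD(1) by (rule category.cod_obj[OF category_RGrph_n])
    have *: "on_obj (direction (Suc n) X n) G \<in> Obj (RGrph (embed X)) \<and>
      Cod (embed X) (gdom (on_obj (direction (Suc n) X n) G)) = on_obj (underlying_object (Suc n) X) G"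
      unfolding direction_Suc_same RGrph_Obj_iff
    proof
      show "reflexive_graph (embed X) (?u (gdom G)) (?u (gcod G)) (?u (gunit G))"
        by (rule reflexive_graphI; (unfold underlying_object_cmp[symmetric] GD(8,9) underlying_object_ide)?;
          (simp only: d c s)?)
    qed (use d in simp)
    show ?case
      using * Suc.IH[OF V] Suc.prems(2) direction_Suc_less(1)[of i n X G]
      by (cases "i = n") simp_all
  qed simp_all
  then show "on_obj (direction n X i) G \<in> Obj (RGrph (embed X))"
    and "Cod (embed X) (gdom (on_obj (direction n X i) G)) = on_obj (underlying_object n X) G"
    by simp_all
qed

lemma direction_hom:
  assumes "h \<in> hom (RGrph_n n X) G H" "i < n"
  shows "on_mor (direction n X i) h \<in>
      hom (RGrph (embed X)) (on_obj (direction n X i) G) (on_obj (direction n X i) H)"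
    and "lower (on_mor (direction n X i) h) = on_mor (underlying_object n X) h"
proof -
  have "on_mor (direction n X i) h \<in>
      hom (RGrph (embed X)) (on_obj (direction n X i) G) (on_obj (direction n X i) H) \<and>
      lower (on_mor (direction n X i) h) = on_mor (underlying_object n X) h"
    using assms
  proof (induction n arbitrary: h G H)
    case (Suc n)
    have h: "h \<in> hom (RGrph (RGrph_n n X)) G H"
      using Suc.prems by simp
    note hD = RGrph_homD[OF h]
    have st: "source h = G" "target h = H"
      using h by (simp_all add: hom_def)
    let ?u = "on_mor (underlying_object n X)"
    note GD = reflexive_graphD[OF RGrph_ObjD(2)[OF hD(1)]] and HD = reflexive_graphD[OF RGrph_ObjD(2)[OF hD(2)]]
    note d = homD[OF underlying_object_hom[OF homI[OF GD(1) refl refl]]]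
      and d' = homD[OF underlying_object_hom[OF homI[OF HD(1) refl refl]]]
    have *: "on_mor (direction (Suc n) X n) h \<in>
        hom (RGrph (embed X)) (on_obj (direction (Suc n) X n) G) (on_obj (direction (Suc n) X n) H)"
      unfolding direction_Suc_same(2) st
    proof (rule RGrph_homI)
      show "on_obj (direction (Suc n) X n) G \<in> Obj (RGrph (embed X))"
        "on_obj (direction (Suc n) X n) H \<in> Obj (RGrph (embed X))"
        using direction_Obj(1)[of _ "Suc n"] hD(1,2) by simp_all
    qed (unfold direction_Suc_same(1) cell.sel underlying_object_cmp[symmetric] hD(10-12) d(2,3) d'(2,3),
        use underlying_object_hom[OF homI[OF hD(4-6)]] underlying_object_hom[OF homI[OF hD(7-9)]]
        in simp_all)
    have **: "lower (on_mor (direction (Suc n) X n) h) = on_mor (underlying_object (Suc n) X) h"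
      by (simp add: direction_Suc_same)
    note IH = Suc.IH[OF homI[OF hD(7-9)]]
    show ?case
      using * ** IH Suc.prems(2) direction_Suc_less[of i n X]
      by (cases "i = n") simp_all
  qed simp_all
  then show "on_mor (direction n X i) h \<in>
      hom (RGrph (embed X)) (on_obj (direction n X i) G) (on_obj (direction n X i) H)"
    and "lower (on_mor (direction n X i) h) = on_mor (underlying_object n X) h"
    by simp_all
qed

end

subsection \<open>Cubes and their kernel relations\<close>

text \<open>The vertices of a kernel pair of \<open>f\<close> are \<open>Dom f\<close>, so
  repeatedly taking domains reaches the object that underlies \<open>Eq_n F\<close>.\<close>

primrec initial_vertex :: "nat \<Rightarrow> ('o, 'm) category \<Rightarrow> ('o, 'm) cell \<Rightarrow> ('o, 'm) cell" where
  "initial_vertex 0 X F = F"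
| "initial_vertex (Suc n) X F = initial_vertex n X (Dom (Arr_n n X) F)"

text \<open>The component of a morphism of \<open>n\<close>-cubes at the initial vertex. When the
  morphism is read as a cube of one dimension more, it is the initial edge in the new
  direction.\<close>

primrec initial_component :: "nat \<Rightarrow> ('o, 'm) cell \<Rightarrow> ('o, 'm) cell" where
  "initial_component 0 h = h"
| "initial_component (Suc n) h = initial_component n (upper h)"

text \<open>\<open>initial_edge n X F i\<close> is the edge of the cube \<open>F\<close> in direction \<open>i < n\<close> out of its initial
  vertex; the value for \<open>i \<ge> n\<close> is junk.\<close>

primrec initial_edge :: "nat \<Rightarrow> ('o, 'm) category \<Rightarrow> ('o, 'm) cell \<Rightarrow> nat \<Rightarrow> ('o, 'm) cell" where
  "initial_edge 0 X F i = F"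
| "initial_edge (Suc n) X F i =
    (if i = n then initial_component n F else initial_edge n X (Dom (Arr_n n X) F) i)"

lemma Eq_n_simps [simp]:
  "on_obj (Eq_n 0 X) F = F" "on_mor (Eq_n 0 X) h = h"
  "on_obj (Eq_n (Suc n) X) F = kernel_graph (RGrph_n n X) (on_mor (Eq_n n X) F)"
  "on_mor (Eq_n (Suc n) X) h = on_mor (Eq (RGrph_n n X)) (Map (on_mor (Eq_n n X) (source h))
    (on_mor (Eq_n n X) (target h)) (on_mor (Eq_n n X) (upper h)) (on_mor (Eq_n n X) (lower h)))"
  by (simp_all add: id_functor_def comp_functor_def Arr_functor_def Eq_def)

declare Eq_n.simps [simp del]

context kernel_base
begin

section \<open>Functoriality of the iterated kernel pair\<close>

lemma category_Arr_n: "category (Arr_n n X)"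
proof (induction n)
  case (Suc n)
  then interpret A: cells "Arr_n n X" by (simp add: cells_def)
  show ?case using A.category_Arr by simp
qed (simp add: category_embed)

text \<open>The three claims are proved together: objects of the next level are morphisms of this
  one, and morphisms of the next level are commuting squares, whose preservation needs composites at
  this level.\<close>

lemma Eq_n_functor:
  "(\<forall>F \<in> Obj (Arr_n n X). on_obj (Eq_n n X) F \<in> Obj (RGrph_n n X)) \<and>
    (\<forall>F G. \<forall>h \<in> hom (Arr_n n X) F G.
      on_mor (Eq_n n X) h \<in> hom (RGrph_n n X) (on_obj (Eq_n n X) F) (on_obj (Eq_n n X) G)) \<and>
    (\<forall>F G H. \<forall>h \<in> hom (Arr_n n X) F G. \<forall>k \<in> hom (Arr_n n X) G H.
      on_mor (Eq_n n X) (k \<cdot>\<^bsub>Arr_n n X\<^esub> h) = on_mor (Eq_n n X) k \<cdot>\<^bsub>RGrph_n n X\<^esub> on_mor (Eq_n n X) h)"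
proof (induction n)
  case (Suc n)
  interpret R: kernel_cells "RGrph_n n X" by (rule RGrph_n_kernel_cells)
  interpret A: cells "Arr_n n X" using category_Arr_n[of n] by (simp add: cells_def)
  let ?E = "on_mor (Eq_n n X)"
  have hom: "?E h \<in> hom (RGrph_n n X) (on_obj (Eq_n n X) F) (on_obj (Eq_n n X) G)"
    if "h \<in> hom (Arr_n n X) F G" for h F G
    using Suc that by blast
  have cmp: "?E (k \<cdot>\<^bsub>Arr_n n X\<^esub> h) = ?E k \<cdot>\<^bsub>RGrph_n n X\<^esub> ?E h"
    if "h \<in> hom (Arr_n n X) F G" "k \<in> hom (Arr_n n X) G H" for h k F G H
    using Suc that by blast
  have Mor: "?E f \<in> Mor (RGrph_n n X)" if "f \<in> Mor (Arr_n n X)" for f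
    using hom[OF homI[OF that refl refl]] by (rule homD)
  have Arr_hom: "Map (?E f) (?E g) (?E (upper h)) (?E (lower h)) \<in> hom (Arr (RGrph_n n X)) (?E f) (?E g)"
    if h: "h \<in> hom (Arr (Arr_n n X)) f g" for h f g
  proof -
    note hD = Arr_homD[OF h]
    note f = homI[OF hD(1) refl refl] and g = homI[OF hD(2) refl refl]
      and u = homI[OF hD(4-6)] and l = homI[OF hD(7-9)]
    have "?E (upper h) \<in> hom (RGrph_n n X) (Dom (RGrph_n n X) (?E f)) (Dom (RGrph_n n X) (?E g))"
      using hom[OF u] unfolding homD(2)[OF hom[OF f]] homD(2)[OF hom[OF g]] .
    moreover have "?E (lower h) \<in> hom (RGrph_n n X) (Cod (RGrph_n n X) (?E f)) (Cod (RGrph_n n X) (?E g))"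
      using hom[OF l] unfolding homD(3)[OF hom[OF f]] homD(3)[OF hom[OF g]] .
    moreover have "?E (lower h) \<cdot>\<^bsub>RGrph_n n X\<^esub> ?E f = ?E g \<cdot>\<^bsub>RGrph_n n X\<^esub> ?E (upper h)"
      unfolding cmp[OF f l, symmetric] cmp[OF u g, symmetric] hD(10) ..
    ultimately show ?thesis
      by (rule Arr_homI[OF Mor[OF hD(1)] Mor[OF hD(2)]])
  qed
  show ?case
  proof (intro conjI ballI allI)
    fix F assume "F \<in> Obj (Arr_n (Suc n) X)"
    then show "on_obj (Eq_n (Suc n) X) F \<in> Obj (RGrph_n (Suc n) X)"
      using R.kernel_graph(1)[OF Mor] by simp
  next
    fix f g h assume "h \<in> hom (Arr_n (Suc n) X) f g"
    then have h: "h \<in> hom (Arr (Arr_n n X)) f g" by simp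
    have "source h = f" "target h = g"
      using h by (simp_all add: hom_def)
    then show "on_mor (Eq_n (Suc n) X) h \<in>
        hom (RGrph_n (Suc n) X) (on_obj (Eq_n (Suc n) X) f) (on_obj (Eq_n (Suc n) X) g)"
      using R.Eq_mor(1)[OF Arr_hom[OF h]] by simp
  next
    fix f g j h k assume "h \<in> hom (Arr_n (Suc n) X) f g" and "k \<in> hom (Arr_n (Suc n) X) g j"
    then have h: "h \<in> hom (Arr (Arr_n n X)) f g" and k: "k \<in> hom (Arr (Arr_n n X)) g j" by simp_all
    have st: "source h = f" "target h = g" "source k = g" "target k = j"
      using h k by (simp_all add: hom_def)
    note hD = Arr_homD[OF h] and kD = Arr_homD[OF k]
    have "?E (upper k \<cdot>\<^bsub>Arr_n n X\<^esub> upper h) = ?E (upper k) \<cdot>\<^bsub>RGrph_n n X\<^esub> ?E (upper h)"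
      by (rule cmp[OF homI[OF hD(4-6)] homI[OF kD(4-6)]])
    moreover have "?E (lower k \<cdot>\<^bsub>Arr_n n X\<^esub> lower h) = ?E (lower k) \<cdot>\<^bsub>RGrph_n n X\<^esub> ?E (lower h)"
      by (rule cmp[OF homI[OF hD(7-9)] homI[OF kD(7-9)]])
    ultimately show "on_mor (Eq_n (Suc n) X) (k \<cdot>\<^bsub>Arr_n (Suc n) X\<^esub> h) =
        on_mor (Eq_n (Suc n) X) k \<cdot>\<^bsub>RGrph_n (Suc n) X\<^esub> on_mor (Eq_n (Suc n) X) h"
      using R.Eq_cmp[OF Arr_hom[OF h] Arr_hom[OF k]] by (simp add: st)
  qed
qed auto

lemma Eq_n_hom:
  assumes "h \<in> hom (Arr_n n X) F G"
  shows "on_mor (Eq_n n X) h \<in> hom (RGrph_n n X) (on_obj (Eq_n n X) F) (on_obj (Eq_n n X) G)"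
  using Eq_n_functor[of n] assms by blast

lemma Eq_n_Mor:
  assumes "F \<in> Mor (Arr_n n X)"
  shows "on_mor (Eq_n n X) F \<in> Mor (RGrph_n n X)"
    and "Dom (RGrph_n n X) (on_mor (Eq_n n X) F) = on_obj (Eq_n n X) (Dom (Arr_n n X) F)"
    and "Cod (RGrph_n n X) (on_mor (Eq_n n X) F) = on_obj (Eq_n n X) (Cod (Arr_n n X) F)"
  using homD[OF Eq_n_hom[OF homI[OF assms refl refl]]] by auto

text \<open>The vertices of a kernel pair lie over the domain of the arrow, so \<open>Eq\<close>
  turns upper components of cubes into lower components of graphs.\<close>

lemma lower_Eq_n:
  assumes h: "h \<in> hom (Arr_n (Suc n) X) F G"
  shows "lower (on_mor (Eq_n (Suc n) X) h) = on_mor (Eq_n n X) (upper h)"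
proof -
  interpret R: kernel_cells "RGrph_n n X" by (rule RGrph_n_kernel_cells)
  have h': "h \<in> hom (Arr (Arr_n n X)) F G"
    using h by simp
  note hD = Arr_homD[OF h']
  have st: "source h = F" "target h = G"
    using h' by (simp_all add: hom_def)
  let ?E = "on_mor (Eq_n n X)"
  note f = homI[OF hD(1) refl refl] and g = homI[OF hD(2) refl refl]
    and u = homI[OF hD(4-6)] and l = homI[OF hD(7-9)]
  have cmp: "?E (lower h) \<cdot>\<^bsub>RGrph_n n X\<^esub> ?E F = ?E G \<cdot>\<^bsub>RGrph_n n X\<^esub> ?E (upper h)"
    using Eq_n_functor[of n] f g u l hD(10) by metis
  have "Map (?E F) (?E G) (?E (upper h)) (?E (lower h)) \<in> hom (Arr (RGrph_n n X)) (?E F) (?E G)"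
    by (rule Arr_homI[OF Eq_n_Mor(1)[OF hD(1)] Eq_n_Mor(1)[OF hD(2)] _ _ cmp])
      (use Eq_n_hom[OF u] Eq_n_hom[OF l] in
        \<open>simp_all only: Eq_n_Mor(2,3)[OF hD(1)] Eq_n_Mor(2,3)[OF hD(2)]\<close>)
  from R.Eq_mor(2)[OF this] show ?thesis
    by (simp add: st)
qed

lemma vertices_Eq_n:
  assumes "F \<in> Mor (Arr_n n X)"
  shows "Cod (RGrph_n n X) (gdom (on_obj (Eq_n (Suc n) X) F)) = on_obj (Eq_n n X) (Dom (Arr_n n X) F)"
proof -
  interpret R: kernel_cells "RGrph_n n X" by (rule RGrph_n_kernel_cells)
  show ?thesis
    using kernel_pairD(5)[OF R.kernel_graph(2)[OF Eq_n_Mor(1)[OF assms]]] Eq_n_Mor(2)[OF assms]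
    by simp
qed

lemma underlying_object_Eq_n:
  assumes "F \<in> Obj (Arr_n n X)"
  shows "on_obj (underlying_object n X) (on_obj (Eq_n n X) F) = initial_vertex n X F"
  using assms
proof (induction n arbitrary: F)
  case (Suc n)
  then show ?case
    using vertices_Eq_n[of F n] category.dom_obj[OF category_Arr_n] by (simp del: Eq_n_simps)
qed simp

lemma underlying_object_Eq_n_mor:
  assumes "h \<in> hom (Arr_n n X) F G"
  shows "on_mor (underlying_object n X) (on_mor (Eq_n n X) h) = initial_component n h"
  using assms
proof (induction n arbitrary: h F G)
  case (Suc n)
  have "h \<in> hom (Arr (Arr_n n X)) F G"
    using Suc.prems by simp
  note hD = Arr_homD[OF this]
  show ?case
    using lower_Eq_n[OF Suc.prems] Suc.IH[OF homI[OF hD(4-6)]] by (simp del: Eq_n_simps)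
qed simp

text \<open>The kernel pair is formed among reflexive graphs but must be an equivalence relation
  inside \<open>ERel_n n\<close>; \<open>kernel_object_in_ERel_n\<close> places its edge object
  there, and then it is a kernel pair in the subcategory as well.\<close>

lemma Eq_n_ERel_n:
  assumes "F \<in> Obj (Arr_n n X)"
  shows "on_obj (Eq_n n X) F \<in> Obj (ERel_n n X)"
  using assms
proof (induction n arbitrary: F)
  case (Suc n)
  interpret R: kernel_cells "RGrph_n n X" by (rule RGrph_n_kernel_cells)
  interpret E: cells "ERel_n n X" by (rule cells_ERel_n)
  have F: "F \<in> Mor (Arr_n n X)"
    using Suc.prems by simp
  note m = Eq_n_Mor[OF F]
  note k = R.kernel_graph[OF m(1)]
  note kD = kernel_pairD[OF k(2)]
  have AB: "Dom (RGrph_n n X) (on_mor (Eq_n n X) F) \<in> Obj (ERel_n n X)"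
    "Cod (RGrph_n n X) (on_mor (Eq_n n X) F) \<in> Obj (ERel_n n X)"
    using Suc.IH category.dom_obj[OF category_Arr_n F] category.cod_obj[OF category_Arr_n F] m(2,3)
    by simp_all
  note K1 = kernel_object_in_ERel_n[OF k(2) AB]
  have "equivalence_relation (ERel_n n X) (gdom (on_obj (Eq_n (Suc n) X) F)) (gcod (on_obj (Eq_n (Suc n) X) F))"
    using E.kernel_pair_equivalence[OF kernel_pair_ERel_n[OF k(2) AB K1]] by simp
  then show ?case
    unfolding ERel_n_Suc_iff using k(1) K1 AB(1) kD(5) by simp
qed simp

text \<open>In the outermost direction, \<open>underlying_object\<close> preserves the kernel pair
  and sends the morphism \<open>on_mor (Eq_n n X) F\<close> to the initial component of
  \<open>F\<close>. The other directions belong to the vertices, which form \<open>Eq_n\<close> of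
  the domain of \<open>F\<close>.\<close>

lemma direction_Eq_n:
  assumes "F \<in> Obj (Arr_n n X)" "i < n"
  shows "is_kernel_pair (embed X) (initial_edge n X F i)
    (gdom (on_obj (direction n X i) (on_obj (Eq_n n X) F)))
    (gcod (on_obj (direction n X i) (on_obj (Eq_n n X) F)))"
  using assms
proof (induction n arbitrary: F)
  case (Suc n)
  interpret R: kernel_cells "RGrph_n n X" by (rule RGrph_n_kernel_cells)
  have F: "F \<in> Mor (Arr_n n X)"
    using Suc.prems by simp
  show ?case
  proof (cases "i = n")
    case True
    show ?thesis
      using underlying_object_kernel_pair[OF R.kernel_graph(2)[OF Eq_n_Mor(1)[OF F]]]
        underlying_object_Eq_n_mor[OF homI[OF F refl refl]]
      by (simp add: True direction_Suc_same(1))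
  next
    case False
    then have "i < n"
      using Suc.prems(2) by simp
    then show ?thesis
      using Suc.IH[OF category.dom_obj[OF category_Arr_n F]] vertices_Eq_n[OF F] False
      by (simp add: direction_Suc_less(1) del: Eq_n_simps)
  qed
qed simp

text \<open>The lifting goes up one direction at a time: a map into the kernel pair of \<open>Eq_n F\<close>, for a cube
  \<open>F\<close> seen as a morphism of cubes, only has to be checked on underlying objects because these are
  faithful on \<open>n\<close>-fold equivalence relations.\<close>

lemma Eq_n_lift:
  assumes "F \<in> Obj (Arr_n n X)" "G \<in> Obj (ERel_n n X)"
    and "f \<in> hom (embed X) (on_obj (underlying_object n X) G) (initial_vertex n X F)"
    and "\<And>i. i < n \<Longrightarrow>
      initial_edge n X F i \<cdot>\<^bsub>embed X\<^esub> (f \<cdot>\<^bsub>embed X\<^esub> gdom (on_obj (direction n X i) G)) =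
      initial_edge n X F i \<cdot>\<^bsub>embed X\<^esub> (f \<cdot>\<^bsub>embed X\<^esub> gcod (on_obj (direction n X i) G))"
  shows "\<exists>h \<in> hom (RGrph_n n X) G (on_obj (Eq_n n X) F). on_mor (underlying_object n X) h = f"
  using assms
proof (induction n arbitrary: F G f)
  case (Suc n)
  interpret R: kernel_cells "RGrph_n n X" by (rule RGrph_n_kernel_cells)
  let ?C = "RGrph_n n X"
  have F: "F \<in> Mor (Arr_n n X)"
    using Suc.prems(1) by simp
  define A B where "A = Dom (Arr_n n X) F" and "B = Cod (Arr_n n X) F"
  define m V where "m = on_mor (Eq_n n X) F" and "V = Cod ?C (gdom G)"
  have FAB: "F \<in> hom (Arr_n n X) A B"
    using F by (simp add: A_def B_def homI)
  have A: "A \<in> Obj (Arr_n n X)" and B: "B \<in> Obj (Arr_n n X)"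
    using category.dom_obj[OF category_Arr_n F] category.cod_obj[OF category_Arr_n F]
    by (simp_all add: A_def B_def)
  note mD = Eq_n_Mor[OF F, folded m_def A_def B_def]
  note GE = Suc.prems(2)[unfolded ERel_n_Suc_iff, folded V_def]
  have G: "G \<in> Obj (RGrph ?C)"
    using GE by simp
  note GD = reflexive_graphD[OF RGrph_ObjD(2)[OF G], folded V_def]
  \<comment> \<open>First the lift on vertices: the face \<open>A\<close> has the same initial
    vertex as \<open>F\<close> and the same initial edges in directions below
    \<open>n\<close>.\<close>
  have "\<exists>h \<in> hom ?C V (on_obj (Eq_n n X) A). on_mor (underlying_object n X) h = f"
  proof (rule Suc.IH[OF A])
    show "V \<in> Obj (ERel_n n X)" using GE by simp
    show "f \<in> hom (embed X) (on_obj (underlying_object n X) V) (initial_vertex n X A)"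
      using Suc.prems(3) by (simp add: V_def A_def)
    show "initial_edge n X A i \<cdot>\<^bsub>embed X\<^esub> (f \<cdot>\<^bsub>embed X\<^esub> gdom (on_obj (direction n X i) V)) =
      initial_edge n X A i \<cdot>\<^bsub>embed X\<^esub> (f \<cdot>\<^bsub>embed X\<^esub> gcod (on_obj (direction n X i) V))" if "i < n" for i
      using Suc.prems(4)[of i] that by (simp add: direction_Suc_less(1) V_def A_def del: embed_simps)
  qed
  then obtain l where l: "l \<in> hom ?C V (on_obj (Eq_n n X) A)" "on_mor (underlying_object n X) l = f"
    by blast
  have ml: "m \<cdot>\<^bsub>?C\<^esub> (l \<cdot>\<^bsub>?C\<^esub> x) \<in> hom ?C (Dom ?C (gdom G)) (on_obj (Eq_n n X) B)"
    if "x \<in> hom ?C (Dom ?C (gdom G)) V" for x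
    using that l(1) homI[OF mD] by (blast intro: R.cmp_hom)
  have "m \<cdot>\<^bsub>?C\<^esub> (l \<cdot>\<^bsub>?C\<^esub> gdom G) = m \<cdot>\<^bsub>?C\<^esub> (l \<cdot>\<^bsub>?C\<^esub> gcod G)"
  proof (rule underlying_object_faithful[of "Dom ?C (gdom G)" n "on_obj (Eq_n n X) B"])
    show "Dom ?C (gdom G) \<in> Obj (ERel_n n X)" using GE by simp
    show "on_obj (Eq_n n X) B \<in> Obj (ERel_n n X)" by (rule Eq_n_ERel_n[OF B])
    show "m \<cdot>\<^bsub>?C\<^esub> (l \<cdot>\<^bsub>?C\<^esub> gdom G) \<in> hom ?C (Dom ?C (gdom G)) (on_obj (Eq_n n X) B)"
      "m \<cdot>\<^bsub>?C\<^esub> (l \<cdot>\<^bsub>?C\<^esub> gcod G) \<in> hom ?C (Dom ?C (gdom G)) (on_obj (Eq_n n X) B)"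
      by (rule ml, use GD in \<open>simp add: hom_def V_def\<close>)+
    \<comment> \<open>Underneath \<open>m\<close> lies the initial edge of \<open>F\<close> in
      direction \<open>n\<close>, so after passing to underlying objects the equation is the
      hypothesis for \<open>i = n\<close>.\<close>
    have "on_mor (underlying_object n X) m = initial_component n F"
      unfolding m_def by (rule underlying_object_Eq_n_mor[OF FAB])
    then show "on_mor (underlying_object n X) (m \<cdot>\<^bsub>?C\<^esub> (l \<cdot>\<^bsub>?C\<^esub> gdom G)) =
      on_mor (underlying_object n X) (m \<cdot>\<^bsub>?C\<^esub> (l \<cdot>\<^bsub>?C\<^esub> gcod G))"
      using Suc.prems(4)[of n]
      by (simp add: underlying_object_cmp l(2) direction_Suc_same(1) del: embed_simps)
  qed
  then obtain h where "h \<in> hom (RGrph ?C) G (kernel_graph ?C m)" "lower h = l"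
    using R.RGrph_hom_to_kernel_pair[OF R.kernel_graph(2)[OF mD(1)] G R.kernel_graph(1)[OF mD(1)]] l(1)
    unfolding mD(2) V_def by blast
  then show ?case
    using l(2) by (intro bexI[of _ h]) (simp_all add: m_def)
qed simp

end

subsection \<open>A cube with prescribed initial edges\<close>

lemma terminal_Arr:
  assumes "category C" "is_terminal C t"
  shows "is_terminal (Arr C) (Ide C t)"
proof -
  interpret category C by fact
  have t: "t \<in> Obj C" and uniq: "\<And>a f g. f \<in> hom C a t \<Longrightarrow> g \<in> hom C a t \<Longrightarrow> f = g"
    and ex: "\<And>a. a \<in> Obj C \<Longrightarrow> \<exists>f. f \<in> hom C a t"
    using assms(2) dom_obj unfolding is_terminal_def hom_def by blast+
  have "\<exists>!h. h \<in> hom (Arr C) f (Ide C t)" if f: "f \<in> Mor C" for f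
  proof -
    obtain u l where u: "u \<in> hom C (Dom C f) t" and l: "l \<in> hom C (Cod C f) t"
      using ex dom_obj[OF f] cod_obj[OF f] by blast
    show ?thesis
    proof (rule ex1I)
      show "Map f (Ide C t) u l \<in> hom (Arr C) f (Ide C t)"
      proof (rule Arr_homI[OF f])
        show "l \<cdot>\<^bsub>C\<^esub> f = Ide C t \<cdot>\<^bsub>C\<^esub> u"
          by (rule uniq[of _ "Dom C f"]) (use f homD[OF u] homD[OF l] t in \<open>simp_all add: hom_def cat_simps\<close>)
      qed (use t u l in \<open>simp_all add: cat_simps\<close>)
      fix h assume h: "h \<in> hom (Arr C) f (Ide C t)"
      note hD = Arr_homD[OF h]
      have "upper h = u" "lower h = l"
        by (rule uniq[OF _ u], use hD(4-6) t in \<open>simp add: hom_def cat_simps\<close>)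
          (rule uniq[OF _ l], use hD(7-9) t in \<open>simp add: hom_def cat_simps\<close>)
      then show "h = Map f (Ide C t) u l"
        using hD(3) by simp
    qed
  qed
  then show ?thesis
    using t by (simp add: is_terminal_def ide_Mor)
qed

context kernel_base
begin

lemma terminal_Arr_n:
  assumes "is_terminal X t"
  shows "\<exists>T. is_terminal (Arr_n n X) T"
proof (induction n)
  case 0
  then show ?case using terminal_embed[OF assms] by auto
next
  case (Suc n)
  then show ?case using terminal_Arr[OF category_Arr_n] by auto
qed

text \<open>The existence half of a right adjoint to the initial vertex: a map out of the initial
  vertex of any cube into \<open>y\<close> extends to a morphism of cubes.\<close>

lemma cube_cofree:
  assumes t: "is_terminal X t" and "y \<in> Obj (embed X)"
  shows "\<exists>T \<in> Obj (Arr_n n X). initial_vertex n X T = y \<and>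
    (\<forall>F \<in> Obj (Arr_n n X). \<forall>f \<in> hom (embed X) (initial_vertex n X F) y.
      \<exists>h \<in> hom (Arr_n n X) F T. initial_component n h = f)"
proof (induction n)
  case 0
  then show ?case using assms(2) by auto
next
  case (Suc n)
  interpret A: category "Arr_n n X" by (rule category_Arr_n)
  obtain T where T: "T \<in> Obj (Arr_n n X)" "initial_vertex n X T = y"
    and lift: "\<And>F f. F \<in> Obj (Arr_n n X) \<Longrightarrow> f \<in> hom (embed X) (initial_vertex n X F) y \<Longrightarrow>
      \<exists>h \<in> hom (Arr_n n X) F T. initial_component n h = f"
    using Suc by blast
  obtain I where I: "is_terminal (Arr_n n X) I"
    using terminal_Arr_n[OF t] by blast
  have uniq: "f = g" if "f \<in> hom (Arr_n n X) a I" "g \<in> hom (Arr_n n X) a I" for a f g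
    using I that A.dom_obj unfolding is_terminal_def hom_def by blast
  have ex: "\<exists>f. f \<in> hom (Arr_n n X) a I" if "a \<in> Obj (Arr_n n X)" for a
    using I that unfolding is_terminal_def by blast
  \<comment> \<open>The next cofree cube is the arrow from the present one to a terminal cube. A
    square into \<open>e\<close> commutes automatically, since both of its sides end in
    \<open>I\<close>.\<close>
  obtain e where e: "e \<in> hom (Arr_n n X) T I"
    using ex T by blast
  have "\<exists>h \<in> hom (Arr_n (Suc n) X) F e. initial_component (Suc n) h = f"
    if F: "F \<in> Obj (Arr_n (Suc n) X)" and f: "f \<in> hom (embed X) (initial_vertex (Suc n) X F) y" for F f
  proof -
    have F': "F \<in> Mor (Arr_n n X)"
      using F by simp
    obtain u where u: "u \<in> hom (Arr_n n X) (Dom (Arr_n n X) F) T" "initial_component n u = f"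
      using lift[OF A.dom_obj[OF F']] f by auto
    obtain l where l: "l \<in> hom (Arr_n n X) (Cod (Arr_n n X) F) I"
      using ex A.cod_obj[OF F'] by blast
    have "l \<cdot>\<^bsub>Arr_n n X\<^esub> F = e \<cdot>\<^bsub>Arr_n n X\<^esub> u"
      by (rule uniq[OF A.cmp_hom[OF homI[OF F' refl refl] l] A.cmp_hom[OF u(1) e]])
    then have "Map F e u l \<in> hom (Arr (Arr_n n X)) F e"
      using u(1) l F' homD[OF e] by (intro Arr_homI) simp_all
    then show ?thesis
      using u(2) by (intro bexI[of _ "Map F e u l"]) simp_all
  qed
  moreover have "e \<in> Obj (Arr_n (Suc n) X)" "initial_vertex (Suc n) X e = y"
    using homD[OF e] T by simp_all
  ultimately show ?case by blast
qed

lemma cube_with_initial_edges: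
  assumes t: "is_terminal X t" and x: "x \<in> Obj (embed X)"
    and "\<And>i. i < n \<Longrightarrow> f i \<in> Mor (embed X) \<and> Dom (embed X) (f i) = x"
  shows "\<exists>F \<in> Obj (Arr_n n X). initial_vertex n X F = x \<and> (\<forall>i<n. initial_edge n X F i = f i)"
  using assms(3)
proof (induction n)
  case 0
  then show ?case using x by auto
next
  case (Suc n)
  then obtain F where F: "F \<in> Obj (Arr_n n X)" "initial_vertex n X F = x" "\<forall>i<n. initial_edge n X F i = f i"
    using less_SucI by blast
  have fn: "f n \<in> Mor (embed X)" "Dom (embed X) (f n) = x"
    using Suc.prems[of n] by auto
  have "Cod (embed X) (f n) \<in> Obj (embed X)"
    using category.cod_obj[OF category_embed fn(1)] .
  \<comment> \<open>A new direction is added by viewing a morphism out of \<open>F\<close> as a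
    cube: mapping into the cofree cube on the codomain of \<open>f n\<close> makes
    \<open>f n\<close> the new initial edge and leaves the old ones, which belong to the domain
    \<open>F\<close>.\<close>
  from cube_cofree[OF t this, of n] obtain T where "\<exists>h \<in> hom (Arr_n n X) F T. initial_component n h = f n"
    using F(1,2) homI[OF fn refl] by metis
  then obtain h where h: "h \<in> hom (Arr_n n X) F T" "initial_component n h = f n" by blast
  show ?case
    by (rule bexI[of _ h]) (use F h homD[OF h(1)] in \<open>auto simp: less_Suc_eq\<close>)
qed

end

subsection \<open>Tuples of equivalence relations\<close>

lemma ERel_simps [simp]:
  "Dom (ERel C) = source" "Cod (ERel C) = target"
  "Ide (ERel C) = Ide (RGrph C)" "Cmp (ERel C) = Cmp (RGrph C)"
  by (simp_all add: ERel_def)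

lemma ERel_Obj_iff:
  "R \<in> Obj (ERel C) \<longleftrightarrow> R \<in> Obj (RGrph C) \<and> equivalence_relation C (gdom R) (gcod R)"
  by (simp add: ERel_def)

lemma hom_ERel:
  "hom (ERel C) R S = (if R \<in> Obj (ERel C) \<and> S \<in> Obj (ERel C) then hom (RGrph C) R S else {})"
  using RGrph_homD(1,2)[of _ C R S] by (auto simp: ERel_def hom_full_subcategory)

lemma ERel_tuples_Obj:
  assumes "x \<in> Obj (embed X)"
    and "\<And>i. i < n \<Longrightarrow> R i \<in> Obj (ERel (embed X)) \<and> Cod (embed X) (gdom (R i)) = x"
  shows "Tuple (x # map R [0..<n]) \<in> Obj (ERel_tuples n X)"
  using assms by (auto simp: ERel_tuples_def Let_def vertices_def simp del: embed_simps)

lemma ERel_tuples_homI: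
  assumes "f \<in> hom (embed X) x y"
    and "\<And>i. i < n \<Longrightarrow> r i \<in> hom (ERel (embed X)) (R i) (S i) \<and> lower (r i) = f"
  shows "Tuple (f # map r [0..<n]) \<in>
    hom (ERel_tuples n X) (Tuple (x # map R [0..<n])) (Tuple (y # map S [0..<n]))"
  using assms by (auto simp: hom_def ERel_tuples_def Let_def vertices_def simp del: embed_simps)

lemma ERel_tuples_homE:
  assumes "g \<in> hom (ERel_tuples n X) (Tuple (x # map R [0..<n])) (Tuple (y # map S [0..<n]))"
  obtains f r where "g = Tuple (f # map r [0..<n])" "f \<in> hom (embed X) x y"
    "\<And>i. i < n \<Longrightarrow> r i \<in> hom (ERel (embed X)) (R i) (S i) \<and> lower (r i) = f"
proof -
  obtain f rs where g: "g = Tuple (f # rs)" and f: "f \<in> hom (embed X) x y" and n: "length rs = n"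
    and rs: "\<forall>r \<in> set rs. r \<in> Mor (ERel (embed X)) \<and> lower r = f"
    and st: "map source rs = map R [0..<n]" "map target rs = map S [0..<n]"
    using assms by (auto simp: hom_def ERel_tuples_def Let_def vertices_def simp del: embed_simps)
  have "rs ! i \<in> hom (ERel (embed X)) (R i) (S i) \<and> lower (rs ! i) = f" if "i < n" for i
    using rs n that arg_cong[OF st(1), of "\<lambda>l. l ! i"] arg_cong[OF st(2), of "\<lambda>l. l ! i"]
    by (simp add: hom_def)
  then show ?thesis
    using that[of f "\<lambda>i. rs ! i"] g f n map_nth[of rs] by simp
qed

lemma ERel_tuples_ide [simp]:
  "Ide (ERel_tuples n X) (Tuple (x # Rs)) = Tuple (Ide (embed X) x # map (Ide (RGrph (embed X))) Rs)"
  by (simp add: ERel_tuples_def Let_def del: embed_simps RGrph_simps)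

lemma ERel_tuples_cmp [simp]:
  "Tuple (g # map s [0..<n]) \<cdot>\<^bsub>ERel_tuples n X\<^esub> Tuple (f # map r [0..<n]) =
    Tuple (g \<cdot>\<^bsub>embed X\<^esub> f # map (\<lambda>i. s i \<cdot>\<^bsub>RGrph (embed X)\<^esub> r i) [0..<n])"
  by (simp add: ERel_tuples_def Let_def map2_map_map del: embed_simps RGrph_simps)

lemma U_simps [simp]:
  "on_obj (U n X) G = Tuple (on_obj (underlying_object n X) G # map (\<lambda>i. on_obj (direction n X i) G) [0..<n])"
  "on_mor (U n X) h = Tuple (on_mor (underlying_object n X) h # map (\<lambda>i. on_mor (direction n X i) h) [0..<n])"
  by (simp_all add: U_def)

lemma (in category) isomorphic_trans:
  assumes "isomorphic C a b" "isomorphic C b c"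
  shows "isomorphic C a c"
proof -
  obtain f f' where f: "f \<in> hom C a b" "f' \<in> hom C b a" "f' \<cdot> f = Ide C a" "f \<cdot> f' = Ide C b"
    using assms(1) unfolding isomorphic_def by blast
  obtain g g' where g: "g \<in> hom C b c" "g' \<in> hom C c b" "g' \<cdot> g = Ide C b" "g \<cdot> g' = Ide C c"
    using assms(2) unfolding isomorphic_def by blast
  have "(f' \<cdot> g') \<cdot> (g \<cdot> f) = f' \<cdot> ((g' \<cdot> g) \<cdot> f)" "(g \<cdot> f) \<cdot> (f' \<cdot> g') = g \<cdot> ((f \<cdot> f') \<cdot> g')"
    using homD[OF f(1)] homD[OF f(2)] homD[OF g(1)] homD[OF g(2)] by (simp_all add: cmp_Mor cmp_assoc)
  then have "(f' \<cdot> g') \<cdot> (g \<cdot> f) = Ide C a" "(g \<cdot> f) \<cdot> (f' \<cdot> g') = Ide C c"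
    using f g by (simp_all add: ide_left)
  then show ?thesis
    unfolding isomorphic_def using cmp_hom[OF f(1) g(1)] cmp_hom[OF g(2) f(2)] by blast
qed

context kernel_base
begin

section \<open>Comparison of kernel cubes with the right adjoint of U\<close>

lemma embed_kernel_cells: "kernel_cells (embed X)"
  using RGrph_n_kernel_cells[of 0] by simp

lemma ERel_tuples_ide_left:
  assumes "g \<in> hom (ERel_tuples n X) (Tuple (x # map R [0..<n])) (Tuple (y # map S [0..<n]))"
  shows "Ide (ERel_tuples n X) (Tuple (y # map S [0..<n])) \<cdot>\<^bsub>ERel_tuples n X\<^esub> g = g"
proof -
  interpret B: kernel_cells "embed X" by (rule embed_kernel_cells)
  obtain f r where g: "g = Tuple (f # map r [0..<n])" and f: "f \<in> hom (embed X) x y"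
    and r: "\<And>i. i < n \<Longrightarrow> r i \<in> hom (ERel (embed X)) (R i) (S i) \<and> lower (r i) = f"
    using ERel_tuples_homE[OF assms] by blast
  have "Ide (RGrph (embed X)) (S i) \<cdot>\<^bsub>RGrph (embed X)\<^esub> r i = r i" if "i < n" for i
    by (rule category.ide_left[OF B.category_RGrph, of _ "R i"])
      (use r[OF that] in \<open>simp add: hom_ERel split: if_splits\<close>)
  then show ?thesis
    using B.ide_left[OF f] by (simp add: g o_def del: embed_simps RGrph_simps)
qed

text \<open>A morphism of tuples is determined by its component \<open>f\<close> between the common
  objects, since relations are jointly monic; its other entries only witness that \<open>f\<close>
  respects the relations, which is exactly what \<open>Eq_n_lift\<close> asks for.\<close>

lemma is_square_Eq_n:
  assumes F: "F \<in> Obj (Arr_n n X)"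
  defines "G \<equiv> on_obj (Eq_n n X) F"
  shows "on_obj (U n X) G \<in> Obj (ERel_tuples n X)" "is_square n X (on_obj (U n X) G) G"
proof -
  interpret B: kernel_cells "embed X" by (rule embed_kernel_cells)
  interpret RB: category "RGrph (embed X)" by (rule B.category_RGrph)
  interpret R: kernel_cells "RGrph_n n X" by (rule RGrph_n_kernel_cells)
  let ?u = "underlying_object n X" and ?dir = "direction n X"
  have GE: "G \<in> Obj (ERel_n n X)"
    unfolding G_def by (rule Eq_n_ERel_n[OF F])
  note GR = ERel_n_subset[OF GE]
  have x: "on_obj ?u G \<in> Obj (embed X)"
    using homD[OF underlying_object_hom[OF R.ide_hom[OF GR]]] by (metis B.cod_obj)
  have kp: "is_kernel_pair (embed X) (initial_edge n X F i) (gdom (on_obj (?dir i) G)) (gcod (on_obj (?dir i) G))"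
    if "i < n" for i
    unfolding G_def by (rule direction_Eq_n[OF F that])
  have dir: "on_obj (?dir i) G \<in> Obj (ERel (embed X))" if "i < n" for i
    using direction_Obj(1)[OF GR that] B.kernel_pair_equivalence[OF kp[OF that]]
    by (simp add: ERel_Obj_iff)
  show tuple: "on_obj (U n X) G \<in> Obj (ERel_tuples n X)"
    unfolding U_simps by (rule ERel_tuples_Obj[OF x]) (use dir direction_Obj(2)[OF GR] in auto)
  let ?I = "Ide (ERel_tuples n X) (on_obj (U n X) G)"
  have "?I \<in> hom (ERel_tuples n X) (on_obj (U n X) G) (on_obj (U n X) G)"
  proof -
    have "Ide (RGrph (embed X)) (on_obj (?dir i) G) \<in> hom (ERel (embed X)) (on_obj (?dir i) G) (on_obj (?dir i) G) \<and>
      lower (Ide (RGrph (embed X)) (on_obj (?dir i) G)) = Ide (embed X) (on_obj ?u G)" if "i < n" for i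
      using dir[OF that] RB.ide_hom[OF direction_Obj(1)[OF GR that]] direction_Obj(2)[OF GR that]
      by (simp add: hom_ERel del: embed_simps)
    from ERel_tuples_homI[OF B.ide_hom[OF x] this] show ?thesis
      by (simp add: o_def del: embed_simps RGrph_simps)
  qed
  moreover have "\<exists>!h. h \<in> hom (ERel_n n X) G' G \<and> ?I \<cdot>\<^bsub>ERel_tuples n X\<^esub> on_mor (U n X) h = g"
    if G': "G' \<in> Obj (ERel_n n X)" and g: "g \<in> hom (ERel_tuples n X) (on_obj (U n X) G') (on_obj (U n X) G)"
    for G' g
  proof -
    obtain f r where g_eq: "g = Tuple (f # map r [0..<n])"
      and f: "f \<in> hom (embed X) (on_obj ?u G') (on_obj ?u G)"
      and r: "\<And>i. i < n \<Longrightarrow> r i \<in> hom (ERel (embed X)) (on_obj (?dir i) G') (on_obj (?dir i) G) \<and> lower (r i) = f"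
      using ERel_tuples_homE[OF g[unfolded U_simps]] by blast
    have rR: "r i \<in> hom (RGrph (embed X)) (on_obj (?dir i) G') (on_obj (?dir i) G)" "lower (r i) = f"
      if "i < n" for i
      using r[OF that] by (auto simp: hom_ERel split: if_splits)
    have "\<exists>h \<in> hom (RGrph_n n X) G' G. on_mor ?u h = f"
      unfolding G_def
    proof (rule Eq_n_lift[OF F G'])
      show "f \<in> hom (embed X) (on_obj ?u G') (initial_vertex n X F)"
        using f by (simp add: G_def underlying_object_Eq_n[OF F])
      fix i assume i: "i < n"
      note k = kernel_pairD[OF kp[OF i]] and rD = RGrph_homD[OF rR(1)[OF i], unfolded rR(2)[OF i]]
      show "initial_edge n X F i \<cdot>\<^bsub>embed X\<^esub> (f \<cdot>\<^bsub>embed X\<^esub> gdom (on_obj (?dir i) G')) =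
          initial_edge n X F i \<cdot>\<^bsub>embed X\<^esub> (f \<cdot>\<^bsub>embed X\<^esub> gcod (on_obj (?dir i) G'))"
        \<comment> \<open>Here \<open>r i\<close> is used: it rewrites \<open>f\<close> after a
          projection of the \<open>i\<close>th relation as a projection of a kernel pair after
          \<open>upper (r i)\<close>, and the edge equalizes the two projections.\<close>
        unfolding rD(10,11)[symmetric]
        by (rule B.square_cmp[OF k(7)]) (use k(1-6) rD(4-6) in \<open>simp_all del: embed_simps\<close>)
    qed
    then obtain h where h: "h \<in> hom (RGrph_n n X) G' G" "on_mor ?u h = f"
      by blast
    have "on_mor (?dir i) h = r i" if i: "i < n" for i
      by (rule B.RGrph_hom_eqI[OF B.kernel_pair_jointly_monic[OF kp[OF i]] direction_hom(1)[OF h(1) i] rR(1)[OF i]])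
        (simp only: direction_hom(2)[OF h(1) i] h(2) rR(2)[OF i])
    then have "on_mor (U n X) h = g"
      using h(2) by (simp add: g_eq)
    then have Uh: "?I \<cdot>\<^bsub>ERel_tuples n X\<^esub> on_mor (U n X) h = g"
      using ERel_tuples_ide_left[OF g[unfolded U_simps]] by simp
    show ?thesis
    proof (rule ex1I)
      show "h \<in> hom (ERel_n n X) G' G \<and> ?I \<cdot>\<^bsub>ERel_tuples n X\<^esub> on_mor (U n X) h = g"
        using h(1) Uh by (simp only: hom_ERel_n[OF G' GE] simp_thms)
      fix k assume k: "k \<in> hom (ERel_n n X) G' G \<and> ?I \<cdot>\<^bsub>ERel_tuples n X\<^esub> on_mor (U n X) k = g"
      then have k': "k \<in> hom (RGrph_n n X) G' G"
        by (simp only: hom_ERel_n[OF G' GE])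
      \<comment> \<open>For uniqueness it suffices to compare the first entries of the tuples, by
        faithfulness.\<close>
      have "Ide (embed X) (on_obj ?u G) \<cdot>\<^bsub>embed X\<^esub> on_mor ?u k = f"
        using k by (simp add: g_eq o_def del: embed_simps RGrph_simps)
      then have "on_mor ?u k = f"
        using B.ide_left[OF underlying_object_hom[OF k']] by simp
      then show "k = h"
        using underlying_object_faithful[OF G' GE k' h(1)] h(2) by simp
    qed
  qed
  ultimately show "is_square n X (on_obj (U n X) G) G"
    unfolding is_square_def universal_from_functor_def using tuple GE by blast
qed

lemma square_isomorphic_Eq_n:
  assumes t: "is_terminal X t"
    and eff: "\<And>d c. equivalence_relation (embed X) d c \<Longrightarrow> \<exists>f. is_kernel_pair (embed X) f d c"
    and R: "R \<in> Obj (ERel_tuples n X)" and S: "is_square n X R S"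
  shows "\<exists>F \<in> Obj (Arr_n n X). isomorphic (RGrph_n n X) S (on_obj (Eq_n n X) F)"
proof -
  interpret B: kernel_cells "embed X" by (rule embed_kernel_cells)
  interpret R: kernel_cells "RGrph_n n X" by (rule RGrph_n_kernel_cells)
  let ?u = "underlying_object n X" and ?dir = "direction n X"
  have US: "on_obj (U n X) S = R" and SE: "S \<in> Obj (ERel_n n X)"
    and univ: "\<And>G g. G \<in> Obj (ERel_n n X) \<Longrightarrow> g \<in> hom (ERel_tuples n X) (on_obj (U n X) G) R \<Longrightarrow>
      \<exists>!h. h \<in> hom (ERel_n n X) G S \<and> Ide (ERel_tuples n X) R \<cdot>\<^bsub>ERel_tuples n X\<^esub> on_mor (U n X) h = g"
    using S unfolding is_square_def universal_from_functor_def by blast+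
  note SR = ERel_n_subset[OF SE]
  define x where "x = on_obj ?u S"
  have R_eq: "R = Tuple (x # map (\<lambda>i. on_obj (?dir i) S) [0..<n])"
    using US by (simp add: x_def)
  have x: "x \<in> Obj (embed X)" and dirS: "\<And>i. i < n \<Longrightarrow> on_obj (?dir i) S \<in> Obj (ERel (embed X))"
    using R by (auto simp: R_eq ERel_tuples_def Let_def simp del: embed_simps)
  have "\<exists>f. is_kernel_pair (embed X) f (gdom (on_obj (?dir i) S)) (gcod (on_obj (?dir i) S))" if "i < n" for i
    using eff dirS[OF that] by (simp add: ERel_Obj_iff)
  then obtain f where f: "\<And>i. i < n \<Longrightarrow>
      is_kernel_pair (embed X) (f i) (gdom (on_obj (?dir i) S)) (gcod (on_obj (?dir i) S))"
    by metis
  have fD: "f i \<in> Mor (embed X) \<and> Dom (embed X) (f i) = x" if "i < n" for i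
    using kernel_pairD(1,5)[OF f[OF that]] direction_Obj(2)[OF SR that] by (simp only: x_def simp_thms)
  obtain F where F: "F \<in> Obj (Arr_n n X)" "initial_vertex n X F = x"
    and edge: "\<And>i. i < n \<Longrightarrow> initial_edge n X F i = f i"
    using cube_with_initial_edges[OF t x, of n f] fD by blast
  define G where "G = on_obj (Eq_n n X) F"
  have GE: "G \<in> Obj (ERel_n n X)"
    unfolding G_def by (rule Eq_n_ERel_n[OF F(1)])
  note GR = ERel_n_subset[OF GE]
  have uG: "on_obj ?u G = x"
    unfolding G_def by (simp add: underlying_object_Eq_n F)
  let ?id = "Ide (embed X) x"
  have id: "?id \<in> hom (embed X) x x"
    by (rule B.ide_hom[OF x])
  have dirG: "is_kernel_pair (embed X) (f i) (gdom (on_obj (?dir i) G)) (gcod (on_obj (?dir i) G))"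
    if "i < n" for i
    using direction_Eq_n[OF F(1) that] by (simp only: edge[OF that] G_def)
  \<comment> \<open>Stated for any graph \<open>H\<close> whose projections are a kernel pair of
    \<open>f i\<close>, because it is applied to the directions of \<open>S\<close> and to those of
    \<open>G\<close>: the former gives \<open>S\<close> to \<open>G\<close> by lifting, the latter
    the morphisms of relations that feed the universal property of \<open>S\<close>.\<close>
  have id_edge: "f i \<cdot>\<^bsub>embed X\<^esub> (?id \<cdot>\<^bsub>embed X\<^esub> gdom H) = f i \<cdot>\<^bsub>embed X\<^esub> (?id \<cdot>\<^bsub>embed X\<^esub> gcod H)"
    if H: "is_kernel_pair (embed X) (f i) (gdom H) (gcod H)" and i: "i < n" for i H
  proof -
    note k = kernel_pairD[OF H]
    have "?id \<cdot>\<^bsub>embed X\<^esub> gdom H = gdom H" "?id \<cdot>\<^bsub>embed X\<^esub> gcod H = gcod H"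
      by (rule B.cmp_ide(1); use k fD[OF i] in \<open>simp del: embed_simps\<close>)+
    then show ?thesis
      using k(7) by (simp only:)
  qed
  have "\<exists>h \<in> hom (RGrph_n n X) S G. on_mor ?u h = ?id"
    unfolding G_def
    by (rule Eq_n_lift[OF F(1) SE])
      (use id id_edge[OF f] in \<open>simp_all only: F(2) x_def edge\<close>)
  then obtain h where h: "h \<in> hom (RGrph_n n X) S G" "on_mor ?u h = ?id"
    by blast
  have "\<exists>r. r \<in> hom (ERel (embed X)) (on_obj (?dir i) G) (on_obj (?dir i) S) \<and> lower r = ?id"
    if i: "i < n" for i
  proof -
    note dG = direction_Obj[OF GR i] and dS = direction_Obj[OF SR i]
    obtain r where "r \<in> hom (RGrph (embed X)) (on_obj (?dir i) G) (on_obj (?dir i) S)" "lower r = ?id"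
      by (rule B.RGrph_hom_to_kernel_pair[OF f[OF i] dG(1) dS(1) _ id_edge[OF dirG[OF i] i]])
        (use id fD[OF i] in \<open>simp only: dG(2) uG\<close>)
    moreover have "on_obj (?dir i) G \<in> Obj (ERel (embed X))"
      using dG(1) B.kernel_pair_equivalence[OF dirG[OF i]] by (simp add: ERel_Obj_iff)
    ultimately show ?thesis
      using dirS[OF i] by (auto simp: hom_ERel)
  qed
  then obtain r where r: "\<And>i. i < n \<Longrightarrow>
      r i \<in> hom (ERel (embed X)) (on_obj (?dir i) G) (on_obj (?dir i) S) \<and> lower (r i) = ?id"
    by metis
  \<comment> \<open>The chosen kernel pairs in \<open>G\<close> need not be the relations in
    \<open>R\<close>, so the tuple morphism over the identity is assembled from the comparisons
    \<open>r i\<close>.\<close>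
  have "Tuple (?id # map r [0..<n]) \<in> hom (ERel_tuples n X) (on_obj (U n X) G) R"
    unfolding U_simps uG R_eq by (rule ERel_tuples_homI[OF id r])
  from univ[OF GE this] obtain k where k: "k \<in> hom (ERel_n n X) G S"
    and Uk: "Ide (ERel_tuples n X) R \<cdot>\<^bsub>ERel_tuples n X\<^esub> on_mor (U n X) k = Tuple (?id # map r [0..<n])"
    by blast
  have k': "k \<in> hom (RGrph_n n X) G S"
    using k by (simp only: hom_ERel_n[OF GE SE])
  have "?id \<cdot>\<^bsub>embed X\<^esub> on_mor ?u k = ?id"
    using Uk by (simp add: R_eq o_def del: embed_simps RGrph_simps)
  then have uk: "on_mor ?u k = ?id"
    using B.ide_left[OF underlying_object_hom[OF k']] by (simp only: x_def)
  have id2: "?id \<cdot>\<^bsub>embed X\<^esub> ?id = ?id"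
    by (rule B.ide_left[OF id])
  \<comment> \<open>Both \<open>h\<close> and \<open>k\<close> lie over the identity of
    \<open>x\<close>, hence so do their composites, and faithfulness makes these identities.\<close>
  have "k \<cdot>\<^bsub>RGrph_n n X\<^esub> h = Ide (RGrph_n n X) S"
    by (rule underlying_object_faithful[OF SE SE R.cmp_hom[OF h(1) k'] R.ide_hom[OF SR]])
      (simp only: underlying_object_cmp underlying_object_ide h(2) uk id2 flip: x_def)
  moreover have "h \<cdot>\<^bsub>RGrph_n n X\<^esub> k = Ide (RGrph_n n X) G"
    by (rule underlying_object_faithful[OF GE GE R.cmp_hom[OF k' h(1)] R.ide_hom[OF GR]])
      (simp only: underlying_object_cmp underlying_object_ide h(2) uk id2 uG)
  ultimately have "isomorphic (RGrph_n n X) S G"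
    unfolding isomorphic_def using h(1) k' by blast
  then show ?thesis
    using F(1) by (auto simp: G_def)
qed

end

theorem mainTheorem2:
  fixes X :: "('o, 'm) category" and n :: nat and E :: "('o, 'm) cell"
  assumes "exact_maltsev X"
    and "n \<ge> 1"
    and "E \<in> Obj (ERel_n n X)"
  shows "effective n X E \<longleftrightarrow> parallelistic n X E"
proof -
  have fc: "finitely_complete X"
    using assms(1) by (simp add: exact_maltsev_def exact_category_def regular_category_def)
  have "has_kernel_pairs X"
    using fc by (auto simp: finitely_complete_def has_kernel_pairs_def)
  then interpret kernel_base X
    using fc by (simp add: kernel_base_def kernel_base_axioms_def finitely_complete_def)
  obtain t where t: "is_terminal X t"
    using fc by (auto simp: finitely_complete_def)
  \<comment> \<open>Exactness, moved to the embedded copy of \<open>X\<close> in which the entries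
    of tuples live.\<close>
  have eff: "\<exists>f. is_kernel_pair (embed X) f d c" if "equivalence_relation (embed X) d c"
    for d c :: "('o, 'm) cell"
  proof -
    obtain d' c' where dc: "d = Mo d'" "c = Mo c'" "equivalence_relation X d' c'"
      using equivalence_relation_embedD[OF \<open>equivalence_relation (embed X) d c\<close>] .
    then obtain f where "is_kernel_pair X f d' c'"
      using assms(1) unfolding exact_maltsev_def exact_category_def by blast
    from kernel_pair_embed[OF this] show ?thesis
      unfolding dc(1,2) by (rule exI)
  qed
  interpret R: category "RGrph_n n X" by (rule category_RGrph_n)
  show ?thesis
  proof
    assume "effective n X E"
    then obtain F where F: "F \<in> Obj (Arr_n n X)" "isomorphic (RGrph_n n X) E (on_obj (Eq_n n X) F)"
      unfolding effective_def by blast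
    \<comment> \<open>Effectiveness speaks of isomorphism among reflexive graphs, parallelism among
      equivalence relations; fullness identifies the two, provided that \<open>Eq_n F\<close> is
      itself an \<open>n\<close>-fold equivalence relation.\<close>
    have "isomorphic (ERel_n n X) E (on_obj (Eq_n n X) F)"
      using F(2) isomorphic_ERel_n[OF assms(3) Eq_n_ERel_n[OF F(1)]] by simp
    then show "parallelistic n X E"
      unfolding parallelistic_def using is_square_Eq_n[OF F(1)] by blast
  next
    assume "parallelistic n X E"
    then obtain R S where RS: "R \<in> Obj (ERel_tuples n X)" "is_square n X R S" "isomorphic (ERel_n n X) E S"
      unfolding parallelistic_def by blast
    have S: "S \<in> Obj (ERel_n n X)"
      using RS(2) unfolding is_square_def universal_from_functor_def by blast
    have "isomorphic (RGrph_n n X) E S"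
      using RS(3) isomorphic_ERel_n[OF assms(3) S] by simp
    then show "effective n X E"
      unfolding effective_def
      using square_isomorphic_Eq_n[OF t eff RS(1,2)] R.isomorphic_trans by blast
  qed
qed

end
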